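(* Let $(M,P,g)$ be a Riemannian almost product manifold with $\mathrm{tr}\,P=0$, $\dim M=2n$, belonging to the class $\overline{\mathcal W}_3\cup\overline{\mathcal W}_6$, and suppose that its associated 1-form $\theta$ is closed. Suppose that the natural connection $D$ on $(M,P,g)$ has parallel torsion $T$ (i.e. $DT=0$), let $R'$ be the curvature tensor of type $(0,4)$ of $D$ and let $R$ be the curvature tensor of type $(0,4)$ of the Levi-Civita connection $\nabla$. Then $E(R')=E(R)$.
   Context: A Riemannian almost product manifold $(M,P,g)$ is a differentiable manifold $M$ with a Riemannian metric $g$ and a $(1,1)$-tensor field $P$ such that $P^2x=x$ and $g(Px,Py)=g(x,y)$; here $\mathrm{tr}\,P=0$ and $\dim M=2n$. $x,y,z,w$ denote arbitrary vector fields (or tangent vectors at a point). $\nabla$ is the Levi-Civita connection of $g$, $F(x,y,z)=g((\nabla_xP)y,z)$, and the associated 1-form is $\theta(x)=g^{ij}F(e_i,e_j,x)$ for a local basis $\{e_i\}$. Class $\overline{\mathcal W}_3$: $F(x,y,z)=\frac1{2n}\{[g(x,y)+g(x,Py)]\theta(z)+[g(x,z)+g(x,Pz)]\theta(y)\}$ and $\theta(Px)=-\theta(x)$. Class $\overline{\mathcal W}_6$: $F(x,y,z)=\frac1{2n}\{[g(x,y)-g(x,Py)]\theta(z)+[g(x,z)-g(x,Pz)]\theta(y)\}$ and $\theta(Px)=\theta(x)$. $(M,P,g)\in\overline{\mathcal W}_3\cup\overline{\mathcal W}_6$ means that $(M,P,g)$ belongs to one of these two classes. A natural connection is a linear connection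 $\nabla'$ with $\nabla'P=\nabla'g=0$. $D$ is the natural connection whose torsion $T(x,y,z)=g(T(x,y),z)$ is $$T(x,y,z)=\tfrac1{2n}\{g(y,z)\theta(Px)-g(x,z)\theta(Py)\}.$$ Curvature: $R(x,y)z=\nabla_x\nabla_yz-\nabla_y\nabla_xz-\nabla_{[x,y]}z$, $R(x,y,z,w)=g(R(x,y)z,w)$, and $R'$ is defined in the same way from $D$. A curvature-like tensor is a $(0,4)$-tensor $L$ with $L(x,y,z,w)=-L(y,x,z,w)=-L(x,y,w,z)$ and $L(x,y,z,w)+L(y,z,x,w)+L(z,x,y,w)=0$. (Under the hypotheses, $R'$ is curvature-like.) For such $L$: $\rho(L)(y,z)=g^{ij}L(e_i,y,z,e_j)$, $\tau(L)=g^{ij}\rho(L)(e_i,e_j)$. With $\pi_1(x,y,z,w)=g(y,z)g(x,w)-g(x,z)g(y,w)$, define $$E(L)=L-\frac{\tau(L)\pi_1}{2n(2n-1)}.$$ *)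

theory Defs
  imports "HOL-Analysis.Analysis"
begin

section \<open>Smooth manifolds\<close>

text \<open>Only used for open \<open>S\<close>. Since the model spaces are finite-dimensional, continuity of all
  iterated directional derivatives is the usual notion of class \<open>C\<^sup>k\<close>.\<close>

fun Ck_on :: "nat \<Rightarrow> 'a::euclidean_space set \<Rightarrow> ('a \<Rightarrow> 'b::euclidean_space) \<Rightarrow> bool" where
  "Ck_on 0 S f = continuous_on S f"
| "Ck_on (Suc k) S f =
     ((\<forall>x\<in>S. f differentiable (at x)) \<and>
      (\<forall>v. Ck_on k S (\<lambda>x. frechet_derivative f (at x) v)))"

definition smooth_on :: "'a::euclidean_space set \<Rightarrow> ('a \<Rightarrow> 'b::euclidean_space) \<Rightarrow> bool" where
  "smooth_on S f \<longleftrightarrow> (\<forall>k. Ck_on k S f)"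

text \<open>A chart is a coordinate domain with its coordinate map; the values of the map outside the
  domain are irrelevant. The manifold is the whole type \<open>'m\<close>; its topology is required to be
  Hausdorff and second countable through the sort of \<open>'m\<close>, and its dimension is \<open>CARD('d)\<close>.\<close>

type_synonym ('m, 'd) chart = "'m set \<times> ('m \<Rightarrow> real ^ 'd)"

definition smooth_atlas ::
    "('m::{t2_space,second_countable_topology}, 'd::finite) chart set \<Rightarrow> bool" where
  "smooth_atlas A \<longleftrightarrow>
     (\<Union>(U, \<phi>)\<in>A. U) = UNIV \<and>
     (\<forall>(U, \<phi>)\<in>A. open U \<and> open (\<phi> ` U) \<and> homeomorphism U (\<phi> ` U) \<phi> (inv_into U \<phi>)) \<and>
     (\<forall>(U, \<phi>)\<in>A. \<forall>(V, \<psi>)\<in>A. smooth_on (\<phi> ` (U \<inter> V)) (\<psi> \<circ> inv_into U \<phi>))"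

definition smooth_functions ::
    "('m::{t2_space,second_countable_topology}, 'd::finite) chart set \<Rightarrow> ('m \<Rightarrow> real) set" where
  "smooth_functions A = {f. \<forall>(U, \<phi>)\<in>A. smooth_on (\<phi> ` U) (f \<circ> inv_into U \<phi>)}"

text \<open>Tangent vectors are point derivations of the algebra of smooth functions. They are set to
  \<open>0\<close> on non-smooth functions, so that equality of derivations is equality of HOL functions.\<close>

type_synonym 'm tvec = "('m \<Rightarrow> real) \<Rightarrow> real"

definition tangent_space ::
    "('m::{t2_space,second_countable_topology}, 'd::finite) chart set \<Rightarrow> 'm \<Rightarrow> 'm tvec set" where
  "tangent_space A p = {v.
     (\<forall>f. f \<notin> smooth_functions A \<longrightarrow> v f = 0) \<and>
     (\<forall>f\<in>smooth_functions A. \<forall>h\<in>smooth_functions A.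
        (\<forall>a b. v (\<lambda>q. a * f q + b * h q) = a * v f + b * v h) \<and>
        v (\<lambda>q. f q * h q) = f p * v h + h p * v f)}"

type_synonym 'm vfield = "'m \<Rightarrow> 'm tvec"

definition vector_fields ::
    "('m::{t2_space,second_countable_topology}, 'd::finite) chart set \<Rightarrow> 'm vfield set" where
  "vector_fields A = {X. (\<forall>p. X p \<in> tangent_space A p) \<and>
     (\<forall>f\<in>smooth_functions A. (\<lambda>p. X p f) \<in> smooth_functions A)}"

definition vf_act :: "'m vfield \<Rightarrow> ('m \<Rightarrow> real) \<Rightarrow> 'm \<Rightarrow> real" where
  "vf_act X f = (\<lambda>p. X p f)"

definition vf_add :: "'m vfield \<Rightarrow> 'm vfield \<Rightarrow> 'm vfield" where
  "vf_add X Y = (\<lambda>p f. X p f + Y p f)"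

definition vf_diff :: "'m vfield \<Rightarrow> 'm vfield \<Rightarrow> 'm vfield" where
  "vf_diff X Y = (\<lambda>p f. X p f - Y p f)"

definition vf_scale :: "('m \<Rightarrow> real) \<Rightarrow> 'm vfield \<Rightarrow> 'm vfield" where
  "vf_scale h X = (\<lambda>p f. h p * X p f)"

definition vf_zero :: "'m vfield" where
  "vf_zero = (\<lambda>p f. 0)"

definition lie_bracket :: "'m vfield \<Rightarrow> 'm vfield \<Rightarrow> 'm vfield" where
  "lie_bracket X Y = (\<lambda>p f. X p (vf_act Y f) - Y p (vf_act X f))"


section \<open>Metrics, fields of endomorphisms and traces\<close>

type_synonym 'm metric = "'m \<Rightarrow> 'm tvec \<Rightarrow> 'm tvec \<Rightarrow> real"
type_synonym 'm endo = "'m \<Rightarrow> 'm tvec \<Rightarrow> 'm tvec"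

definition gf :: "'m metric \<Rightarrow> 'm vfield \<Rightarrow> 'm vfield \<Rightarrow> 'm \<Rightarrow> real" where
  "gf g X Y = (\<lambda>p. g p (X p) (Y p))"

definition ef :: "'m endo \<Rightarrow> 'm vfield \<Rightarrow> 'm vfield" where
  "ef P X = (\<lambda>p. P p (X p))"

definition riemannian_metric ::
    "('m::{t2_space,second_countable_topology}, 'd::finite) chart set \<Rightarrow> 'm metric \<Rightarrow> bool" where
  "riemannian_metric A g \<longleftrightarrow>
     (\<forall>p. \<forall>u\<in>tangent_space A p. \<forall>v\<in>tangent_space A p.
        g p u v = g p v u \<and>
        (u \<noteq> (\<lambda>f. 0) \<longrightarrow> g p u u > 0) \<and>
        (\<forall>w\<in>tangent_space A p. \<forall>a b.
           g p (\<lambda>f. a * u f + b * v f) w = a * g p u w + b * g p v w)) \<and>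
     (\<forall>X\<in>vector_fields A. \<forall>Y\<in>vector_fields A. gf g X Y \<in> smooth_functions A)"

definition tensor_field_11 ::
    "('m::{t2_space,second_countable_topology}, 'd::finite) chart set \<Rightarrow> 'm endo \<Rightarrow> bool" where
  "tensor_field_11 A P \<longleftrightarrow>
     (\<forall>p. \<forall>u\<in>tangent_space A p. P p u \<in> tangent_space A p \<and>
        (\<forall>v\<in>tangent_space A p. \<forall>a b.
           P p (\<lambda>f. a * u f + b * v f) = (\<lambda>f. a * P p u f + b * P p v f))) \<and>
     (\<forall>X\<in>vector_fields A. ef P X \<in> vector_fields A)"

definition tangent_basis ::
    "('m::{t2_space,second_countable_topology}, 'd::finite) chart set \<Rightarrow> 'm \<Rightarrow> ('d \<Rightarrow> 'm tvec) \<Rightarrow> bool"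
  where
  "tangent_basis A p b \<longleftrightarrow> (\<forall>i. b i \<in> tangent_space A p) \<and>
     (\<forall>v\<in>tangent_space A p. \<exists>!c::real^'d. v = (\<lambda>f. \<Sum>i\<in>UNIV. c $ i * b i f))"

text \<open>Covariant tensor fields are maps on vector fields, so a local basis around \<open>p\<close> is given by
  global vector fields that are a basis at \<open>p\<close> (hence near \<open>p\<close>); such fields exist
  by a cut-off argument. All traces below are independent of the chosen frame.\<close>

definition frame_at ::
    "('m::{t2_space,second_countable_topology}, 'd::finite) chart set \<Rightarrow> 'm \<Rightarrow> ('d \<Rightarrow> 'm vfield) \<Rightarrow> bool"
  where
  "frame_at A p e \<longleftrightarrow> (\<forall>i. e i \<in> vector_fields A) \<and> tangent_basis A p (\<lambda>i. e i p)"

definition some_frame ::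
    "('m::{t2_space,second_countable_topology}, 'd::finite) chart set \<Rightarrow> 'm \<Rightarrow> 'd \<Rightarrow> 'm vfield"
  where
  "some_frame A p = (SOME e. frame_at A p e)"

text \<open>\<open>contract A g B\<close> is \<open>g\<^sup>i\<^sup>j B(e\<^sub>i, e\<^sub>j)\<close>.\<close>

definition contract ::
    "('m::{t2_space,second_countable_topology}, 'd::finite) chart set \<Rightarrow> 'm metric \<Rightarrow>
      ('m vfield \<Rightarrow> 'm vfield \<Rightarrow> 'm \<Rightarrow> real) \<Rightarrow> 'm \<Rightarrow> real" where
  "contract A g B = (\<lambda>p.
     let e = some_frame A p;
         G = (\<chi> i j. gf g (e i) (e j) p) :: real^'d^'d
     in \<Sum>i\<in>UNIV. \<Sum>j\<in>UNIV. matrix_inv G $ i $ j * B (e i) (e j) p)"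

definition endo_trace ::
    "('m::{t2_space,second_countable_topology}, 'd::finite) chart set \<Rightarrow> 'm endo \<Rightarrow> 'm \<Rightarrow> real" where
  "endo_trace A P p =
     (let e = some_frame A p
      in trace (THE M::real^'d^'d.
           \<forall>j. P p (e j p) = (\<lambda>f. \<Sum>i\<in>UNIV. M $ i $ j * e i p f)))"

definition almost_product_manifold ::
    "('m::{t2_space,second_countable_topology}, 'd::finite) chart set \<Rightarrow> 'm endo \<Rightarrow> 'm metric \<Rightarrow> bool"
  where
  "almost_product_manifold A P g \<longleftrightarrow>
     smooth_atlas A \<and> riemannian_metric A g \<and> tensor_field_11 A P \<and>
     (\<forall>p. \<forall>u\<in>tangent_space A p. P p (P p u) = u \<and>
        (\<forall>v\<in>tangent_space A p. g p (P p u) (P p v) = g p u v))"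


section \<open>Linear connections\<close>

text \<open>Everything about a connection is stated for smooth vector fields only; its values on other
  arguments are irrelevant.\<close>

type_synonym 'm conn = "'m vfield \<Rightarrow> 'm vfield \<Rightarrow> 'm vfield"

definition linear_connection ::
    "('m::{t2_space,second_countable_topology}, 'd::finite) chart set \<Rightarrow> 'm conn \<Rightarrow> bool" where
  "linear_connection A N \<longleftrightarrow>
     (\<forall>X\<in>vector_fields A. \<forall>Y\<in>vector_fields A. N X Y \<in> vector_fields A) \<and>
     (\<forall>X\<in>vector_fields A. \<forall>X'\<in>vector_fields A. \<forall>Y\<in>vector_fields A.
        N (vf_add X X') Y = vf_add (N X Y) (N X' Y)) \<and>
     (\<forall>X\<in>vector_fields A. \<forall>Y\<in>vector_fields A. \<forall>Y'\<in>vector_fields A.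
        N X (vf_add Y Y') = vf_add (N X Y) (N X Y')) \<and>
     (\<forall>X\<in>vector_fields A. \<forall>Y\<in>vector_fields A. \<forall>h\<in>smooth_functions A.
        N (vf_scale h X) Y = vf_scale h (N X Y) \<and>
        N X (vf_scale h Y) = vf_add (vf_scale (vf_act X h) Y) (vf_scale h (N X Y)))"

definition torsion :: "'m conn \<Rightarrow> 'm vfield \<Rightarrow> 'm vfield \<Rightarrow> 'm vfield" where
  "torsion N X Y = vf_diff (vf_diff (N X Y) (N Y X)) (lie_bracket X Y)"

definition parallel_metric ::
    "('m::{t2_space,second_countable_topology}, 'd::finite) chart set \<Rightarrow> 'm conn \<Rightarrow> 'm metric \<Rightarrow> bool"
  where
  "parallel_metric A N g \<longleftrightarrow>
     (\<forall>X\<in>vector_fields A. \<forall>Y\<in>vector_fields A. \<forall>Z\<in>vector_fields A. \<forall>p.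
        vf_act X (gf g Y Z) p - gf g (N X Y) Z p - gf g Y (N X Z) p = 0)"

definition levi_civita ::
    "('m::{t2_space,second_countable_topology}, 'd::finite) chart set \<Rightarrow> 'm metric \<Rightarrow> 'm conn \<Rightarrow> bool"
  where
  "levi_civita A g N \<longleftrightarrow>
     linear_connection A N \<and> parallel_metric A N g \<and>
     (\<forall>X\<in>vector_fields A. \<forall>Y\<in>vector_fields A. torsion N X Y = vf_zero)"

definition deriv_endo :: "'m conn \<Rightarrow> 'm endo \<Rightarrow> 'm vfield \<Rightarrow> 'm vfield \<Rightarrow> 'm vfield" where
  "deriv_endo N P X Y = vf_diff (N X (ef P Y)) (ef P (N X Y))"

definition natural_connection ::
    "('m::{t2_space,second_countable_topology}, 'd::finite) chart set \<Rightarrow> 'm endo \<Rightarrow> 'm metric \<Rightarrow>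
      'm conn \<Rightarrow> bool" where
  "natural_connection A P g D \<longleftrightarrow>
     linear_connection A D \<and> parallel_metric A D g \<and>
     (\<forall>X\<in>vector_fields A. \<forall>Y\<in>vector_fields A. deriv_endo D P X Y = vf_zero)"

definition parallel_torsion ::
    "('m::{t2_space,second_countable_topology}, 'd::finite) chart set \<Rightarrow> 'm conn \<Rightarrow> bool" where
  "parallel_torsion A D \<longleftrightarrow>
     (\<forall>W\<in>vector_fields A. \<forall>X\<in>vector_fields A. \<forall>Y\<in>vector_fields A.
        vf_diff (vf_diff (D W (torsion D X Y)) (torsion D (D W X) Y)) (torsion D X (D W Y)) = vf_zero)"

definition curvature :: "'m conn \<Rightarrow> 'm vfield \<Rightarrow> 'm vfield \<Rightarrow> 'm vfield \<Rightarrow> 'm vfield" where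
  "curvature N X Y Z = vf_diff (vf_diff (N X (N Y Z)) (N Y (N X Z))) (N (lie_bracket X Y) Z)"

type_synonym 'm tensor4 = "'m vfield \<Rightarrow> 'm vfield \<Rightarrow> 'm vfield \<Rightarrow> 'm vfield \<Rightarrow> 'm \<Rightarrow> real"

definition curvature4 :: "'m metric \<Rightarrow> 'm conn \<Rightarrow> 'm tensor4" where
  "curvature4 g N X Y Z W = gf g (curvature N X Y Z) W"


section \<open>The structure tensor, its associated 1-form and the two classes\<close>

definition F_tensor ::
    "'m metric \<Rightarrow> 'm endo \<Rightarrow> 'm conn \<Rightarrow> 'm vfield \<Rightarrow> 'm vfield \<Rightarrow> 'm vfield \<Rightarrow> 'm \<Rightarrow> real" where
  "F_tensor g P N X Y Z = gf g (deriv_endo N P X Y) Z"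

definition assoc_form ::
    "('m::{t2_space,second_countable_topology}, 'd::finite) chart set \<Rightarrow> 'm metric \<Rightarrow> 'm endo \<Rightarrow>
      'm conn \<Rightarrow> 'm vfield \<Rightarrow> 'm \<Rightarrow> real" where
  "assoc_form A g P N X = contract A g (\<lambda>Y Z. F_tensor g P N Y Z X)"

definition closed_form ::
    "('m::{t2_space,second_countable_topology}, 'd::finite) chart set \<Rightarrow>
      ('m vfield \<Rightarrow> 'm \<Rightarrow> real) \<Rightarrow> bool" where
  "closed_form A \<theta> \<longleftrightarrow>
     (\<forall>X\<in>vector_fields A. \<forall>Y\<in>vector_fields A. \<forall>p.
        vf_act X (\<theta> Y) p - vf_act Y (\<theta> X) p - \<theta> (lie_bracket X Y) p = 0)"

text \<open>In the following definitions \<open>N\<close> is the Levi-Civita connection and \<open>2 n\<close> the dimension.\<close>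

definition class_W3 ::
    "nat \<Rightarrow> ('m::{t2_space,second_countable_topology}, 'd::finite) chart set \<Rightarrow> 'm endo \<Rightarrow> 'm metric \<Rightarrow>
      'm conn \<Rightarrow> bool" where
  "class_W3 n A P g N \<longleftrightarrow> (let \<theta> = assoc_form A g P N in
     (\<forall>X\<in>vector_fields A. \<forall>Y\<in>vector_fields A. \<forall>Z\<in>vector_fields A. \<forall>p.
        F_tensor g P N X Y Z p =
          1 / (2 * real n) * ((gf g X Y p + gf g X (ef P Y) p) * \<theta> Z p
                            + (gf g X Z p + gf g X (ef P Z) p) * \<theta> Y p)) \<and>
     (\<forall>X\<in>vector_fields A. \<forall>p. \<theta> (ef P X) p = - \<theta> X p))"

definition class_W6 ::
    "nat \<Rightarrow> ('m::{t2_space,second_countable_topology}, 'd::finite) chart set \<Rightarrow> 'm endo \<Rightarrow> 'm metric \<Rightarrow>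
      'm conn \<Rightarrow> bool" where
  "class_W6 n A P g N \<longleftrightarrow> (let \<theta> = assoc_form A g P N in
     (\<forall>X\<in>vector_fields A. \<forall>Y\<in>vector_fields A. \<forall>Z\<in>vector_fields A. \<forall>p.
        F_tensor g P N X Y Z p =
          1 / (2 * real n) * ((gf g X Y p - gf g X (ef P Y) p) * \<theta> Z p
                            + (gf g X Z p - gf g X (ef P Z) p) * \<theta> Y p)) \<and>
     (\<forall>X\<in>vector_fields A. \<forall>p. \<theta> (ef P X) p = \<theta> X p))"

text \<open>A metric connection is determined by its torsion, so this predicate characterizes
  \<open>D\<close> uniquely.\<close>

definition connection_D ::
    "nat \<Rightarrow> ('m::{t2_space,second_countable_topology}, 'd::finite) chart set \<Rightarrow> 'm endo \<Rightarrow> 'm metric \<Rightarrow>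
      'm conn \<Rightarrow> 'm conn \<Rightarrow> bool" where
  "connection_D n A P g N D \<longleftrightarrow> natural_connection A P g D \<and> (let \<theta> = assoc_form A g P N in
     (\<forall>X\<in>vector_fields A. \<forall>Y\<in>vector_fields A. \<forall>Z\<in>vector_fields A. \<forall>p.
        gf g (torsion D X Y) Z p =
          1 / (2 * real n) * (gf g Y Z p * \<theta> (ef P X) p - gf g X Z p * \<theta> (ef P Y) p)))"


section \<open>Ricci tensor, scalar curvature and the tensor E\<close>

definition ricci ::
    "('m::{t2_space,second_countable_topology}, 'd::finite) chart set \<Rightarrow> 'm metric \<Rightarrow> 'm tensor4 \<Rightarrow>
      'm vfield \<Rightarrow> 'm vfield \<Rightarrow> 'm \<Rightarrow> real" where
  "ricci A g L Y Z = contract A g (\<lambda>U V. L U Y Z V)"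

definition scal ::
    "('m::{t2_space,second_countable_topology}, 'd::finite) chart set \<Rightarrow> 'm metric \<Rightarrow> 'm tensor4 \<Rightarrow>
      'm \<Rightarrow> real" where
  "scal A g L = contract A g (ricci A g L)"

definition pi1 :: "'m metric \<Rightarrow> 'm tensor4" where
  "pi1 g X Y Z W p = gf g Y Z p * gf g X W p - gf g X Z p * gf g Y W p"

definition E_tensor ::
    "nat \<Rightarrow> ('m::{t2_space,second_countable_topology}, 'd::finite) chart set \<Rightarrow> 'm metric \<Rightarrow>
      'm tensor4 \<Rightarrow> 'm tensor4" where
  "E_tensor n A g L X Y Z W p =
     L X Y Z W p - scal A g L p * pi1 g X Y Z W p / (2 * real n * (2 * real n - 1))"

end

theory Submission
  imports Defs
begin

text \<open>
  Write \<open>\<alpha>(X) = \<theta>(P X) / 2n\<close>, so that \<open>D\<close> is a metric connection with torsion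
  \<open>T(X,Y) = \<alpha>(X) Y - \<alpha>(Y) X\<close>. Such a connection differs from the Levi-Civita connection \<open>\<nabla>\<close>
  by the tensor \<open>S = D - \<nabla>\<close> with \<open>S(X,Y) = g(X,Y) \<alpha>\<^sup>\<sharp> - \<alpha>(Y) X\<close> (\<open>S_formula\<close>). In covariant form \<open>S\<close> is
  the torsion with permuted arguments, \<open>g(S(X,Y),Z) = g(T(Z,Y),X)\<close>, so \<open>D T = 0\<close> implies
  \<open>D S = 0\<close> (\<open>S_parallel\<close>). Hence the curvatures are related without any derivative of \<open>S\<close>,
  \<open>R(X,Y) Z = R'(X,Y) Z + S(X, S(Y,Z)) - S(Y, S(X,Z)) - S(T(X,Y), Z)\<close> (\<open>curvature_relation\<close>), and the
  algebraic terms collapse to \<open>R = R' - |\<alpha>|\<^sup>2 \<pi>\<^sub>1\<close> (\<open>curvature_D\<close>). Since \<open>\<tau>(\<pi>\<^sub>1) = 2n (2n - 1)\<close>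
  (\<open>scal_add_pi1\<close>), the operator \<open>E\<close> annihilates every multiple of \<open>\<pi>\<^sub>1\<close>, and \<open>E(R') = E(R)\<close>.

  The trace of \<open>\<pi>\<^sub>1\<close> and the dual vector \<open>\<alpha>\<^sup>\<sharp>\<close> at a point use that at every point some global
  smooth vector fields form a basis of the space of derivations (\<open>frame_exists\<close>). This
  rests on the calculus of \<open>C\<^sup>k\<close> maps, smooth bump functions built from
  \<open>exp (-1/t)\<close>, and Hadamard's lemma \<open>f(x) = f(a) + \<Sum>\<^sub>i (x\<^sub>i - a\<^sub>i) h\<^sub>i(x)\<close> with smooth \<open>h\<^sub>i\<close>, by which a
  derivation at a point is determined by its values on coordinate functions.
\<close>

section \<open>Calculus of \<open>C\<^sup>k\<close> maps\<close>

lemma frechet_derivative_has: "f differentiable (at x) \<Longrightarrow> (f has_derivative frechet_derivative f (at x)) (at x)"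
  by (simp add: frechet_derivative_works[symmetric])

lemma frechet_derivative_cong_open:
  assumes "open S" "x \<in> S" "\<And>y. y \<in> S \<Longrightarrow> f y = g y" "f differentiable (at x)"
  shows "g differentiable (at x)" "frechet_derivative g (at x) = frechet_derivative f (at x)"
proof -
  have "(g has_derivative frechet_derivative f (at x)) (at x)"
    using has_derivative_transform_within_open[OF frechet_derivative_has[OF assms(4)] assms(1,2)] assms(3)
    by blast
  then show "g differentiable (at x)" "frechet_derivative g (at x) = frechet_derivative f (at x)"
    by (auto simp: differentiable_def frechet_derivative_at[symmetric])
qed

lemma linear_real_expansion:
  fixes L :: "'a::euclidean_space \<Rightarrow> real"
  assumes "linear L"
  shows "L v = (\<Sum>b\<in>Basis. (v \<bullet> b) * L b)"
proof -
  have "L v = L (\<Sum>b\<in>Basis. (v \<bullet> b) *\<^sub>R b)" by (simp only: euclidean_representation)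
  also have "\<dots> = (\<Sum>b\<in>Basis. (v \<bullet> b) * L b)" by (simp only: linear_sum[OF assms] linear_cmul[OF assms] real_scaleR_def)
  finally show ?thesis .
qed

lemma Ck_on_cong:
  assumes "open S" "\<And>y. y \<in> S \<Longrightarrow> f y = g y" "Ck_on k S f"
  shows "Ck_on k S g"
  using assms(2,3)
proof (induction k arbitrary: f g)
  case 0
  then show ?case by (simp cong: continuous_on_cong)
next
  case (Suc k)
  show ?case
    unfolding Ck_on.simps
  proof (intro conjI ballI allI)
    fix x assume "x \<in> S"
    then show "g differentiable (at x)"
      using frechet_derivative_cong_open[OF assms(1)] Suc.prems by (metis Ck_on.simps(2))
  next
    fix v
    show "Ck_on k S (\<lambda>x. frechet_derivative g (at x) v)"
    proof (rule Suc.IH)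
      show "Ck_on k S (\<lambda>x. frechet_derivative f (at x) v)" using Suc.prems by simp
      fix y assume "y \<in> S"
      then show "frechet_derivative f (at y) v = frechet_derivative g (at y) v"
        using frechet_derivative_cong_open(2)[OF assms(1)] Suc.prems by (metis Ck_on.simps(2))
    qed
  qed
qed

lemma Ck_on_Suc_continuous: "Ck_on (Suc k) S f \<Longrightarrow> continuous_on S f"
  by (meson Ck_on.simps(2) continuous_at_imp_continuous_on differentiable_imp_continuous_within)

lemma Ck_on_continuous: "Ck_on k S f \<Longrightarrow> continuous_on S f"
proof (cases k)
  case (Suc m)
  assume "Ck_on k S f" then show ?thesis unfolding Suc by (rule Ck_on_Suc_continuous)
qed simp

lemma Ck_on_SucD: "Ck_on (Suc k) S f \<Longrightarrow> Ck_on k S f"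
proof (induction k arbitrary: f)
  case 0
  then show ?case unfolding Ck_on.simps(1) by (rule Ck_on_Suc_continuous)
next
  case (Suc k)
  have "Ck_on k S (\<lambda>x. frechet_derivative f (at x) v)" for v
    by (rule Suc.IH) (use Suc.prems in \<open>simp only: Ck_on.simps(2)[of "Suc k"]\<close>)
  with Suc.prems show ?case by simp
qed

lemma Ck_on_subset: "Ck_on k S f \<Longrightarrow> T \<subseteq> S \<Longrightarrow> Ck_on k T f"
  by (induction k arbitrary: f) (auto intro: continuous_on_subset)

text \<open>Membership in \<open>C\<^sup>k\<close> is a local property.\<close>
lemma Ck_on_local:
  assumes "\<And>x. x \<in> S \<Longrightarrow> \<exists>T. open T \<and> x \<in> T \<and> Ck_on k T f"
  shows "Ck_on k S f"
  using assms
proof (induction k arbitrary: f)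
  case 0
  show ?case
    unfolding Ck_on.simps
  proof (rule continuous_at_imp_continuous_on, rule ballI)
    fix x assume "x \<in> S"
    with 0 obtain T where "open T" "x \<in> T" "Ck_on 0 T f" by blast
    then show "isCont f x" by (metis Ck_on.simps(1) continuous_on_eq_continuous_at)
  qed
next
  case (Suc k)
  have "f differentiable (at x)" if "x \<in> S" for x
    using Suc.prems[OF that] by (metis Ck_on.simps(2))
  moreover have "Ck_on k S (\<lambda>x. frechet_derivative f (at x) v)" for v
  proof (rule Suc.IH)
    fix x assume "x \<in> S"
    then obtain T where "open T" "x \<in> T" "Ck_on (Suc k) T f" using Suc.prems by blast
    then show "\<exists>T. open T \<and> x \<in> T \<and> Ck_on k T (\<lambda>x. frechet_derivative f (at x) v)"
      by (intro exI[of _ T]) simp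
  qed
  ultimately show ?case by simp
qed

lemma Ck_on_SucI:
  assumes "open S" "\<And>x. x \<in> S \<Longrightarrow> (f has_derivative f' x) (at x)" "\<And>v. Ck_on k S (\<lambda>x. f' x v)"
  shows "Ck_on (Suc k) S f"
  unfolding Ck_on.simps
proof (intro conjI ballI allI)
  fix x assume "x \<in> S" then show "f differentiable (at x)" using assms(2) by (auto simp: differentiable_def)
next
  fix v show "Ck_on k S (\<lambda>x. frechet_derivative f (at x) v)"
    by (rule Ck_on_cong[OF assms(1) _ assms(3)[of v]]) (use frechet_derivative_at[OF assms(2)] in metis)
qed

lemma Ck_on_deriv:
  "Ck_on (Suc k) S f \<Longrightarrow> x \<in> S \<Longrightarrow> (f has_derivative frechet_derivative f (at x)) (at x)"
  by (simp add: frechet_derivative_has)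

lemma Ck_on_const: "Ck_on k S (\<lambda>x. c)"
  by (induction k arbitrary: c) auto

lemma Ck_on_bounded_linear:
  assumes "open S" "bounded_linear L" shows "Ck_on k S L"
proof (cases k)
  case 0
  then show ?thesis using assms(2) by (simp add: linear_continuous_on)
next
  case (Suc m)
  show ?thesis
    unfolding Suc by (rule Ck_on_SucI[where f' = "\<lambda>_. L"])
      (auto intro: assms Ck_on_const bounded_linear_imp_has_derivative)
qed

lemma Ck_on_linear_comp:
  assumes "open S" "Ck_on k S f" "bounded_linear L"
  shows "Ck_on k S (\<lambda>x. L (f x))"
  using assms(2)
proof (induction k arbitrary: f)
  case 0
  then show ?case using assms(3) by (simp add: bounded_linear.continuous_on)
next
  case (Suc k)
  show ?case
    by (rule Ck_on_SucI[OF assms(1) bounded_linear.has_derivative[OF assms(3) Ck_on_deriv[OF Suc.prems]]])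
      (assumption, rule Suc.IH, use Suc.prems in simp)
qed

lemma Ck_on_add:
  assumes "open S" "Ck_on k S f" "Ck_on k S g"
  shows "Ck_on k S (\<lambda>x. f x + g x)"
  using assms(2,3)
proof (induction k arbitrary: f g)
  case 0
  then show ?case by (simp add: continuous_on_add)
next
  case (Suc k)
  show ?case
    by (rule Ck_on_SucI[OF assms(1) has_derivative_add[OF Ck_on_deriv[OF Suc.prems(1)] Ck_on_deriv[OF Suc.prems(2)]]])
      (assumption, assumption, rule Suc.IH, use Suc.prems in simp_all)
qed

lemma Ck_on_mult:
  fixes f g :: "'a::euclidean_space \<Rightarrow> real"
  assumes "open S" "Ck_on k S f" "Ck_on k S g"
  shows "Ck_on k S (\<lambda>x. f x * g x)"
  using assms(2,3)
proof (induction k arbitrary: f g)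
  case 0
  then show ?case by (simp add: continuous_on_mult)
next
  case (Suc k)
  have "Ck_on k S (\<lambda>x. f x * frechet_derivative g (at x) v + frechet_derivative f (at x) v * g x)" for v
    by (rule Ck_on_add[OF assms(1) Suc.IH[OF Ck_on_SucD[OF Suc.prems(1)]] Suc.IH[OF _ Ck_on_SucD[OF Suc.prems(2)]]])
      (use Suc.prems in simp_all)
  then show ?case
    by (intro Ck_on_SucI[OF assms(1) has_derivative_mult[OF Ck_on_deriv[OF Suc.prems(1)] Ck_on_deriv[OF Suc.prems(2)]]])
qed

lemma Ck_on_sum:
  assumes "open S" "\<And>i. i \<in> I \<Longrightarrow> Ck_on k S (f i)"
  shows "Ck_on k S (\<lambda>x. \<Sum>i\<in>I. f i x)"
  using assms(2)
  by (induction I rule: infinite_finite_induct) (auto intro: Ck_on_const Ck_on_add assms(1))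

lemma Ck_on_compose:
  fixes h :: "'b::euclidean_space \<Rightarrow> real"
  assumes "open S" "open T" "f ` S \<subseteq> T" "Ck_on k S f" "Ck_on k T h"
  shows "Ck_on k S (\<lambda>x. h (f x))"
  using assms(4,5)
proof (induction k arbitrary: h)
  case 0
  then show ?case using assms(3) by (auto intro: continuous_on_compose2)
next
  case (Suc k)
  have k: "Ck_on k S f" by (rule Ck_on_SucD[OF Suc.prems(1)])
  have lin: "linear (frechet_derivative h (at (f x)))" if "x \<in> S" for x
    using Ck_on_deriv[OF Suc.prems(2)] that assms(3) has_derivative_linear by blast
  have eq: "frechet_derivative h (at (f x)) (frechet_derivative f (at x) v) =
     (\<Sum>b\<in>Basis. (frechet_derivative f (at x) v \<bullet> b) * frechet_derivative h (at (f x)) b)"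
    if "x \<in> S" for x v
    by (rule linear_real_expansion[OF lin[OF that]])
  show ?case
  proof (rule Ck_on_SucI[OF assms(1)])
    fix x assume x: "x \<in> S"
    show "((\<lambda>x. h (f x)) has_derivative
       (\<lambda>v. \<Sum>b\<in>Basis. (frechet_derivative f (at x) v \<bullet> b) * frechet_derivative h (at (f x)) b)) (at x)"
      unfolding eq[OF x, symmetric]
      by (rule has_derivative_compose[OF Ck_on_deriv[OF Suc.prems(1) x] Ck_on_deriv[OF Suc.prems(2)]])
        (use x assms(3) in blast)
  next
    fix v
    show "Ck_on k S (\<lambda>x. \<Sum>b\<in>Basis. (frechet_derivative f (at x) v \<bullet> b) * frechet_derivative h (at (f x)) b)"
    proof (intro Ck_on_sum Ck_on_mult assms(1))
      fix b :: 'b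
      show "Ck_on k S (\<lambda>x. frechet_derivative f (at x) v \<bullet> b)"
        by (rule Ck_on_linear_comp[OF assms(1) _ bounded_linear_inner_left]) (use Suc.prems in simp)
      show "Ck_on k S (\<lambda>x. frechet_derivative h (at (f x)) b)"
        by (rule Suc.IH[OF k]) (use Suc.prems in simp)
    qed
  qed
qed

lemma smooth_on_subset: "smooth_on S f \<Longrightarrow> T \<subseteq> S \<Longrightarrow> smooth_on T f"
  by (auto simp: smooth_on_def intro: Ck_on_subset)

lemma smooth_on_deriv: "smooth_on S f \<Longrightarrow> smooth_on S (\<lambda>x. frechet_derivative f (at x) v)"
  unfolding smooth_on_def by (metis Ck_on.simps(2))

lemma smooth_on_has_derivative:
  "smooth_on S f \<Longrightarrow> x \<in> S \<Longrightarrow> (f has_derivative frechet_derivative f (at x)) (at x)"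
  unfolding smooth_on_def by (metis Ck_on_deriv)

lemma smooth_on_cong: "open S \<Longrightarrow> smooth_on S f \<Longrightarrow> (\<And>y. y \<in> S \<Longrightarrow> f y = g y) \<Longrightarrow> smooth_on S g"
  unfolding smooth_on_def using Ck_on_cong by blast

lemma smooth_on_local:
  "(\<And>x. x \<in> S \<Longrightarrow> \<exists>T. open T \<and> x \<in> T \<and> smooth_on T f) \<Longrightarrow> smooth_on S f"
  unfolding smooth_on_def by (intro allI Ck_on_local) blast

lemma smooth_on_const: "smooth_on S (\<lambda>x. c)"
  by (simp add: smooth_on_def Ck_on_const)

lemma smooth_on_add: "open S \<Longrightarrow> smooth_on S f \<Longrightarrow> smooth_on S g \<Longrightarrow> smooth_on S (\<lambda>x. f x + g x)"
  by (simp add: smooth_on_def Ck_on_add)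

lemma smooth_on_mult:
  fixes f g :: "'a::euclidean_space \<Rightarrow> real"
  shows "open S \<Longrightarrow> smooth_on S f \<Longrightarrow> smooth_on S g \<Longrightarrow> smooth_on S (\<lambda>x. f x * g x)"
  by (simp add: smooth_on_def Ck_on_mult)

lemma smooth_on_compose:
  fixes h :: "'b::euclidean_space \<Rightarrow> real"
  shows "open S \<Longrightarrow> open T \<Longrightarrow> f ` S \<subseteq> T \<Longrightarrow> smooth_on S f \<Longrightarrow> smooth_on T h \<Longrightarrow> smooth_on S (\<lambda>x. h (f x))"
  by (simp add: smooth_on_def Ck_on_compose)

section \<open>Bump functions\<close>

text \<open>The function \<open>t \<mapsto> t\<^sup>-\<^sup>m exp (-1/t)\<close> for \<open>t > 0\<close>, extended by \<open>0\<close>. Only \<open>flat 0\<close> enters the bump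
  function; the whole family is needed because it is closed under differentiation up to
  linear combinations, which gives smoothness by induction.\<close>
definition flat :: "nat \<Rightarrow> real \<Rightarrow> real" where
  "flat m t = (if t > 0 then exp (- (1 / t)) / t ^ m else 0)"

lemma flat_tendsto_0: "(flat m \<longlongrightarrow> 0) (at 0)"
proof -
  have "((\<lambda>s::real. s ^ m / exp s) \<longlongrightarrow> 0) at_top" by (rule tendsto_power_div_exp_0)
  then have "((\<lambda>t::real. inverse t ^ m / exp (inverse t)) \<longlongrightarrow> 0) (at_right 0)"
    by (rule filterlim_compose[OF _ filterlim_inverse_at_top_right])
  then have R: "(flat m \<longlongrightarrow> 0) (at_right 0)"
    by (rule Lim_transform_eventually)
       (auto simp: eventually_at_filter flat_def exp_minus field_simps power_inverse inverse_eq_divide)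
  have L: "(flat m \<longlongrightarrow> 0) (at_left 0)"
    by (rule tendsto_eventually) (auto simp: eventually_at_filter flat_def)
  show ?thesis using L R by (simp add: filterlim_split_at)
qed

lemma flat_has_derivative:
  "(flat m has_real_derivative flat (m + 2) x - real m * flat (m + 1) x) (at x)"
proof -
  consider "x > 0" | "x < 0" | "x = 0" by linarith
  then show ?thesis
  proof cases
    case 1
    have "((\<lambda>t. exp (- (1 / t)) / t ^ m) has_real_derivative flat (m + 2) x - real m * flat (m + 1) x) (at x)"
      using 1 by (auto intro!: derivative_eq_intros simp: flat_def field_simps power2_eq_square)
        (cases m; simp add: field_simps)
    then show ?thesis
      by (rule has_field_derivative_transform_within_open[where S="{0<..}"]) (use 1 in \<open>auto simp: flat_def\<close>)
  next
    case 2
    have "((\<lambda>t. 0) has_real_derivative flat (m + 2) x - real m * flat (m + 1) x) (at x)"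
      using 2 by (simp add: flat_def)
    then show ?thesis
      by (rule has_field_derivative_transform_within_open[where S="{..<0}"]) (use 2 in \<open>auto simp: flat_def\<close>)
  next
    case 3
    have "((\<lambda>t. (flat m t - flat m 0) / (t - 0)) \<longlongrightarrow> 0) (at 0)"
      by (rule Lim_transform_eventually[OF flat_tendsto_0[of "Suc m"]])
        (auto simp: eventually_at_filter flat_def)
    then show ?thesis using 3 by (simp add: has_field_derivative_iff flat_def)
  qed
qed

lemma Ck_on_flat: "Ck_on k UNIV (flat m)"
proof (induction k arbitrary: m)
  case 0
  show ?case
    by (simp add: continuous_at_imp_continuous_on DERIV_isCont[OF flat_has_derivative])
next
  case (Suc k)
  show ?case
  proof (rule Ck_on_SucI)
    show "(flat m has_derivative (\<lambda>v. (flat (m + 2) x + (- real m) * flat (m + 1) x) * v)) (at x)" for x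
      using flat_has_derivative[of m x] by (simp add: has_field_derivative_def)
    show "Ck_on k UNIV (\<lambda>x. (flat (m + 2) x + (- real m) * flat (m + 1) x) * v)" for v
      by (intro Ck_on_mult Ck_on_add Ck_on_const Suc.IH open_UNIV)
  qed simp
qed

text \<open>For \<open>r > 0\<close>, a smooth function with value \<open>1\<close> at \<open>a\<close> that vanishes outside the closed ball of radius \<open>r\<close>.
  It need not be constant near \<open>a\<close>.\<close>
definition bump :: "'a::euclidean_space \<Rightarrow> real \<Rightarrow> 'a \<Rightarrow> real" where
  "bump a r x = flat 0 (r\<^sup>2 - (x - a) \<bullet> (x - a)) / flat 0 (r\<^sup>2)"

lemma bump_center: "r > 0 \<Longrightarrow> bump a r a = 1"
  by (simp add: bump_def flat_def)

lemma bump_outside: "r > 0 \<Longrightarrow> x \<notin> cball a r \<Longrightarrow> bump a r x = 0"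
proof -
  assume "r > 0" "x \<notin> cball a r"
  then have "r\<^sup>2 \<le> (norm (x - a))\<^sup>2"
    by (intro power_mono) (auto simp: dist_norm norm_minus_commute)
  then show ?thesis by (simp add: bump_def flat_def power2_norm_eq_inner)
qed

lemma smooth_on_bump: "smooth_on UNIV (bump a r)"
proof -
  have c: "Ck_on k UNIV (\<lambda>x. (x - a) \<bullet> b)" for b :: 'a and k
    using Ck_on_add[OF open_UNIV Ck_on_bounded_linear[OF open_UNIV bounded_linear_inner_left] Ck_on_const, of k b "- (a \<bullet> b)"]
    by (simp add: inner_diff_left)
  have "Ck_on k UNIV (\<lambda>x. r\<^sup>2 + (-1) * (\<Sum>b\<in>Basis. ((x - a) \<bullet> b) * ((x - a) \<bullet> b)))" for k
    by (intro Ck_on_add Ck_on_mult Ck_on_sum c Ck_on_const open_UNIV)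
  then have "Ck_on k UNIV (\<lambda>x. r\<^sup>2 - (x - a) \<bullet> (x - a))" for k
    by (simp add: euclidean_inner[of "x - a" "x - a" for x])
  then have "Ck_on k UNIV (\<lambda>x. flat 0 (r\<^sup>2 - (x - a) \<bullet> (x - a)) * inverse (flat 0 (r\<^sup>2)))" for k
    by (intro Ck_on_mult Ck_on_const open_UNIV Ck_on_compose[OF open_UNIV open_UNIV _ _ Ck_on_flat]) auto
  then show ?thesis by (simp add: smooth_on_def bump_def[abs_def] divide_inverse)
qed

text \<open>Multiplying by a bump function turns a locally defined smooth function into a global one.
  The values of \<open>h\<close> outside \<open>W\<close> are irrelevant.\<close>
lemma smooth_on_bump_mult:
  fixes h :: "'a::euclidean_space \<Rightarrow> real"
  assumes "0 < r" "cball a r \<subseteq> W" "open W" "smooth_on W h"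
  shows "smooth_on UNIV (\<lambda>x. bump a r x * h x)"
proof (rule smooth_on_local)
  fix x
  show "\<exists>T. open T \<and> x \<in> T \<and> smooth_on T (\<lambda>x. bump a r x * h x)"
  proof (cases "x \<in> W")
    case True
    have "smooth_on W (\<lambda>x. bump a r x * h x)"
      by (intro smooth_on_mult assms smooth_on_subset[OF smooth_on_bump]) auto
    then show ?thesis using True assms(3) by blast
  next
    case False
    have "smooth_on (- cball a r) (\<lambda>x. bump a r x * h x)"
      by (rule smooth_on_cong[OF _ smooth_on_const[of _ 0]]) (auto simp: bump_outside[OF assms(1)] simp flip: mem_cball)
    then show ?thesis using False assms(2) by (intro exI[of _ "- cball a r"]) auto
  qed
qed

section \<open>Hadamard's lemma\<close>

text \<open>Differentiating under the integral sign in direction \<open>v\<close> replaces \<open>f\<close> by its directional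
  derivative and \<open>m\<close> by \<open>m + 1\<close>; the factor \<open>t\<^sup>m\<close> makes the family closed under this operation.\<close>
lemma Ck_on_ray_integral:
  fixes f :: "'a::euclidean_space \<Rightarrow> real"
  assumes S: "open S" "convex S" "a \<in> S" and f: "smooth_on S f"
  shows "Ck_on k S (\<lambda>x. integral {0..1} (\<lambda>t. t ^ m * f (a + t *\<^sub>R (x - a))))"
  using f
proof (induction k arbitrary: m f)
  have seg: "a + t *\<^sub>R (x - a) \<in> S" if "x \<in> S" "t \<in> {0..1}" for x t
    using convexD[OF S(2) S(3) that(1), of "1 - t" t] that(2) by (simp add: algebra_simps)
  have cont: "continuous_on (S \<times> cbox 0 1) (\<lambda>z. h (a + snd z *\<^sub>R (fst z - a)))"
    if "smooth_on S h" for h :: "'a \<Rightarrow> real"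
  proof (rule continuous_on_compose2[of S h])
    show "continuous_on S h" using that Ck_on_continuous unfolding smooth_on_def by blast
  qed (auto intro!: continuous_intros seg)
  {
    case 0
    have "continuous_on S (\<lambda>x. integral (cbox 0 1) (\<lambda>t. t ^ m * f (a + t *\<^sub>R (x - a))))"
      by (rule integral_continuous_on_param)
        (auto simp: split_beta intro!: continuous_intros cont[OF 0] simp del: box_real)
    then show ?case by simp
  next
    case (Suc k)
    define f' where "f' b x = frechet_derivative f (at x) b" for b x
    have f': "smooth_on S (f' b)" for b unfolding f'_def[abs_def] by (rule smooth_on_deriv[OF Suc.prems])
    \<comment> \<open>The total derivative of the integrand as a bounded linear map: writing it in coordinates
      makes its joint continuity in \<open>x\<close> and \<open>t\<close> evident.\<close>
    define F where "F x t = (\<Sum>b\<in>Basis. (t ^ Suc m * f' b (a + t *\<^sub>R (x - a))) *\<^sub>R blinfun_inner_left b)" for x t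
    have F: "blinfun_apply (F x t) v = t ^ Suc m * f' v (a + t *\<^sub>R (x - a))" if "x \<in> S" "t \<in> {0..1}" for x t v
    proof -
      have lin: "linear (\<lambda>v. f' v (a + t *\<^sub>R (x - a)))"
        unfolding f'_def using has_derivative_linear[OF smooth_on_has_derivative[OF Suc.prems seg[OF that]]] .
      have "f' v (a + t *\<^sub>R (x - a)) = (\<Sum>b\<in>Basis. (v \<bullet> b) * f' b (a + t *\<^sub>R (x - a)))"
        by (rule linear_real_expansion[OF lin])
      then show ?thesis
        by (simp add: F_def blinfun.sum_left blinfun.scaleR_left sum_distrib_left ac_simps inner_commute)
    qed
    show ?case
    proof (rule Ck_on_SucI[OF S(1)])
      fix x assume x: "x \<in> S"
      have "((\<lambda>x. integral (cbox 0 1) (\<lambda>t. t ^ m * f (a + t *\<^sub>R (x - a)))) has_derivative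
          integral (cbox 0 1) (F x)) (at x within S)"
      proof (rule leibniz_rule[OF _ _ _ x S(2)])
        fix y t assume y: "y \<in> S" "t \<in> cbox 0 (1::real)"
        have "((\<lambda>y. f (a + t *\<^sub>R (y - a))) has_derivative (\<lambda>v. f' (t *\<^sub>R v) (a + t *\<^sub>R (y - a)))) (at y)"
          unfolding f'_def
        proof (rule has_derivative_compose[where f = "\<lambda>y. a + t *\<^sub>R (y - a)" and g = f])
          show "((\<lambda>y. a + t *\<^sub>R (y - a)) has_derivative (\<lambda>v. t *\<^sub>R v)) (at y)"
            by (auto intro!: derivative_eq_intros)
          show "(f has_derivative frechet_derivative f (at (a + t *\<^sub>R (y - a)))) (at (a + t *\<^sub>R (y - a)))"
            by (rule smooth_on_has_derivative[OF Suc.prems seg]) (use y in auto)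
        qed
        moreover have "f' (t *\<^sub>R v) (a + t *\<^sub>R (y - a)) = t * f' v (a + t *\<^sub>R (y - a))" for v
          using linear_cmul[OF has_derivative_linear[OF smooth_on_has_derivative[OF Suc.prems seg]]] y
          by (auto simp: f'_def)
        ultimately have "((\<lambda>y. t ^ m * f (a + t *\<^sub>R (y - a))) has_derivative
            (\<lambda>v. t ^ m * (t * f' v (a + t *\<^sub>R (y - a))))) (at y)"
          by (simp add: has_derivative_mult_right)
        moreover have "(\<lambda>v. t ^ m * (t * f' v (a + t *\<^sub>R (y - a)))) = blinfun_apply (F y t)"
          using F[of y t] y by (auto simp: ac_simps)
        ultimately show "((\<lambda>y. t ^ m * f (a + t *\<^sub>R (y - a))) has_derivative blinfun_apply (F y t)) (at y within S)"
          by (simp add: has_derivative_at_withinI)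
      next
        fix y assume y: "y \<in> S"
        have "continuous_on (cbox 0 1) (\<lambda>t. f (a + t *\<^sub>R (y - a)))"
          by (rule continuous_on_compose2[OF cont[OF Suc.prems], where f = "\<lambda>t. (y, t)", simplified])
            (use y in \<open>auto intro!: continuous_intros\<close>)
        then show "(\<lambda>t. t ^ m * f (a + t *\<^sub>R (y - a))) integrable_on cbox 0 1"
          by (intro integrable_continuous continuous_intros)
      next
        show "continuous_on (S \<times> cbox 0 1) (\<lambda>(x, t). F x t)"
          unfolding F_def split_beta by (intro continuous_intros cont f')
      qed
      moreover have "blinfun_apply (integral (cbox 0 1) (F x)) = (\<lambda>v. integral {0..1} (\<lambda>t. t ^ Suc m * f' v (a + t *\<^sub>R (x - a))))"
      proof
        fix v
        have "continuous_on (cbox 0 1) (\<lambda>t. f' b (a + t *\<^sub>R (x - a)))" for b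
          by (rule continuous_on_compose2[OF cont[OF f'], where f = "\<lambda>t. (x, t)", simplified])
            (use x in \<open>auto intro!: continuous_intros\<close>)
        then have "F x integrable_on cbox 0 1"
          unfolding F_def by (intro integrable_continuous continuous_intros)
        then have "blinfun_apply (integral (cbox 0 1) (F x)) v = integral (cbox 0 1) (\<lambda>t. blinfun_apply (F x t) v)"
          by (rule blinfun_apply_integral)
        also have "\<dots> = integral {0..1} (\<lambda>t. t ^ Suc m * f' v (a + t *\<^sub>R (x - a)))"
          unfolding box_real by (rule integral_cong) (rule F[OF x])
        finally show "blinfun_apply (integral (cbox 0 1) (F x)) v = \<dots>" .
      qed
      ultimately show "((\<lambda>x. integral {0..1} (\<lambda>t. t ^ m * f (a + t *\<^sub>R (x - a)))) has_derivative
          (\<lambda>v. integral {0..1} (\<lambda>t. t ^ Suc m * f' v (a + t *\<^sub>R (x - a))))) (at x)"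
        by (simp only: box_real at_within_open[OF x S(1)])
    next
      fix v show "Ck_on k S (\<lambda>x. integral {0..1} (\<lambda>t. t ^ Suc m * f' v (a + t *\<^sub>R (x - a))))"
        by (rule Suc.IH[OF f'])
    qed
  }
qed

lemma hadamard:
  fixes f :: "'a::euclidean_space \<Rightarrow> real"
  assumes S: "open S" "convex S" "a \<in> S" and f: "smooth_on S f"
  obtains h where "\<And>b. smooth_on S (h b)"
    and "\<And>x. x \<in> S \<Longrightarrow> f x = f a + (\<Sum>b\<in>Basis. ((x - a) \<bullet> b) * h b x)"
    and "\<And>b. h b a = frechet_derivative f (at a) b"
proof
  define h where "h b x = integral {0..1} (\<lambda>t. t ^ 0 * frechet_derivative f (at (a + t *\<^sub>R (x - a))) b)" for b x
  show "smooth_on S (h b)" for b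
    unfolding smooth_on_def h_def[abs_def]
    by (intro allI Ck_on_ray_integral S smooth_on_deriv f)
  show "h b a = frechet_derivative f (at a) b" for b
    by (simp add: h_def)
  fix x assume x: "x \<in> S"
  have seg: "a + t *\<^sub>R (x - a) \<in> S" if "t \<in> {0..1}" for t
    using convexD[OF S(2) S(3) x, of "1 - t" t] that by (simp add: algebra_simps)
  have lin: "frechet_derivative f (at y) (x - a) = (\<Sum>b\<in>Basis. ((x - a) \<bullet> b) * frechet_derivative f (at y) b)"
    if "y \<in> S" for y
    by (rule linear_real_expansion[OF has_derivative_linear[OF smooth_on_has_derivative[OF f that]]])
  have cont: "continuous_on {0..1} (\<lambda>t. frechet_derivative f (at (a + t *\<^sub>R (x - a))) b)" for b
  proof (rule continuous_on_compose2[of S "\<lambda>y. frechet_derivative f (at y) b"])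
    show "continuous_on S (\<lambda>y. frechet_derivative f (at y) b)"
      using smooth_on_deriv[OF f, of b] Ck_on_continuous unfolding smooth_on_def by blast
  qed (auto intro!: continuous_intros seg)
  have "((\<lambda>t. frechet_derivative f (at (a + t *\<^sub>R (x - a))) (x - a)) has_integral
      f (a + 1 *\<^sub>R (x - a)) - f (a + 0 *\<^sub>R (x - a))) {0..1}"
  proof (rule fundamental_theorem_of_calculus)
    fix t :: real assume t: "t \<in> {0..1}"
    have "((\<lambda>t. f (a + t *\<^sub>R (x - a))) has_derivative
        (\<lambda>s. frechet_derivative f (at (a + t *\<^sub>R (x - a))) (s *\<^sub>R (x - a)))) (at t)"
    proof (rule has_derivative_compose[where f = "\<lambda>t. a + t *\<^sub>R (x - a)" and g = f])
      show "((\<lambda>t. a + t *\<^sub>R (x - a)) has_derivative (\<lambda>s. s *\<^sub>R (x - a))) (at t)"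
        by (auto intro!: derivative_eq_intros)
      show "(f has_derivative frechet_derivative f (at (a + t *\<^sub>R (x - a)))) (at (a + t *\<^sub>R (x - a)))"
        by (rule smooth_on_has_derivative[OF f seg[OF t]])
    qed
    then show "((\<lambda>t. f (a + t *\<^sub>R (x - a))) has_vector_derivative
        frechet_derivative f (at (a + t *\<^sub>R (x - a))) (x - a)) (at t within {0..1})"
      unfolding has_vector_derivative_def
      using linear_cmul[OF has_derivative_linear[OF smooth_on_has_derivative[OF f seg[OF t]]]]
      by (auto intro: has_derivative_at_withinI)
  qed simp
  then have "f x - f a = integral {0..1} (\<lambda>t. frechet_derivative f (at (a + t *\<^sub>R (x - a))) (x - a))"
    by (simp add: has_integral_integrable_integral)
  also have "\<dots> = integral {0..1} (\<lambda>t. \<Sum>b\<in>Basis. ((x - a) \<bullet> b) * frechet_derivative f (at (a + t *\<^sub>R (x - a))) b)"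
    by (rule integral_cong) (rule lin[OF seg])
  also have "\<dots> = (\<Sum>b\<in>Basis. ((x - a) \<bullet> b) * h b x)"
    by (subst integral_sum) (auto simp: h_def intro!: integrable_continuous_real continuous_intros cont)
  finally show "f x = f a + (\<Sum>b\<in>Basis. ((x - a) \<bullet> b) * h b x)" by simp
qed

section \<open>Smooth functions and tangent vectors on a manifold\<close>

lemma sum_Basis_axis: "(\<Sum>b\<in>(Basis :: (real^'d) set). f b) = (\<Sum>i\<in>UNIV. f (axis i 1))"
proof -
  have "(Basis :: (real^'d) set) = (\<lambda>i. axis i 1) ` UNIV" by (auto simp: Basis_vec_def)
  moreover have "inj (\<lambda>i::'d. axis i (1::real))" by (auto simp: inj_on_def axis_eq_axis)
  ultimately show ?thesis using sum.reindex[of "\<lambda>i::'d. axis i (1::real)" UNIV f] by (simp only: o_def)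
qed

context
  fixes A :: "('m::{t2_space,second_countable_topology}, 'd::finite) chart set"
  assumes atlas: "smooth_atlas A"
begin

lemma chart_at:
  obtains U \<phi> where "(U, \<phi>) \<in> A" "p \<in> U"
proof -
  have "p \<in> (\<Union>(U, \<phi>)\<in>A. U)" using atlas by (simp add: smooth_atlas_def)
  then show ?thesis using that by auto
qed

lemma chart_facts:
  assumes "(U, \<phi>) \<in> A"
  shows "open U" "open (\<phi> ` U)" "homeomorphism U (\<phi> ` U) \<phi> (inv_into U \<phi>)"
proof -
  have "\<forall>(U, \<phi>)\<in>A. open U \<and> open (\<phi> ` U) \<and> homeomorphism U (\<phi> ` U) \<phi> (inv_into U \<phi>)"
    using atlas by (simp add: smooth_atlas_def)
  from bspec[OF this assms] show "open U" "open (\<phi> ` U)" "homeomorphism U (\<phi> ` U) \<phi> (inv_into U \<phi>)"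
    by simp_all
qed

lemma chart_inv:
  assumes "(U, \<phi>) \<in> A" "q \<in> U"
  shows "inv_into U \<phi> (\<phi> q) = q"
  using homeomorphism_apply1[OF chart_facts(3)[OF assms(1)] assms(2)] .

lemma transition_smooth:
  assumes "(U, \<phi>) \<in> A" "(V, \<psi>) \<in> A"
  shows "smooth_on (\<phi> ` (U \<inter> V)) (\<psi> \<circ> inv_into U \<phi>)"
proof -
  have "\<forall>(U, \<phi>)\<in>A. \<forall>(V, \<psi>)\<in>A. smooth_on (\<phi> ` (U \<inter> V)) (\<psi> \<circ> inv_into U \<phi>)"
    using atlas by (simp add: smooth_atlas_def)
  from bspec[OF this assms(1)] assms(2) show ?thesis by auto
qed

lemma chart_image_open:
  assumes "(U, \<phi>) \<in> A" "open V" "V \<subseteq> U"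
  shows "open (\<phi> ` V)"
proof -
  have "openin (top_of_set U) V" using assms(2,3) by (simp add: openin_open_eq chart_facts(1)[OF assms(1)] open_subset)
  then have "openin (top_of_set (\<phi> ` U)) (\<phi> ` V)"
    by (rule homeomorphism_imp_open_map[OF chart_facts(3)[OF assms(1)]])
  then show ?thesis using chart_facts(2)[OF assms(1)] by (meson openin_open_trans)
qed

lemma smooth_functionsD:
  "f \<in> smooth_functions A \<Longrightarrow> (U, \<phi>) \<in> A \<Longrightarrow> smooth_on (\<phi> ` U) (\<lambda>x. f (inv_into U \<phi> x))"
  unfolding smooth_functions_def o_def by blast

lemma smooth_functionsI:
  "(\<And>U \<phi>. (U, \<phi>) \<in> A \<Longrightarrow> smooth_on (\<phi> ` U) (\<lambda>x. f (inv_into U \<phi> x))) \<Longrightarrow> f \<in> smooth_functions A"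
  unfolding smooth_functions_def o_def by blast

lemma smooth_functions_const: "(\<lambda>q. c) \<in> smooth_functions A"
  by (intro smooth_functionsI smooth_on_const)

lemma smooth_functions_add:
  "f \<in> smooth_functions A \<Longrightarrow> h \<in> smooth_functions A \<Longrightarrow> (\<lambda>q. f q + h q) \<in> smooth_functions A"
  by (rule smooth_functionsI, rule smooth_on_add)
    (rule chart_facts(2) smooth_functionsD, assumption+)+

lemma smooth_functions_mult:
  "f \<in> smooth_functions A \<Longrightarrow> h \<in> smooth_functions A \<Longrightarrow> (\<lambda>q. f q * h q) \<in> smooth_functions A"
  by (rule smooth_functionsI, rule smooth_on_mult)
    (rule chart_facts(2) smooth_functionsD, assumption+)+

lemma smooth_functions_sum:
  "(\<And>i. i \<in> I \<Longrightarrow> f i \<in> smooth_functions A) \<Longrightarrow> (\<lambda>q. \<Sum>i\<in>I. f i q) \<in> smooth_functions A"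
  by (induction I rule: infinite_finite_induct) (auto intro: smooth_functions_const smooth_functions_add)

text \<open>The Hausdorff property is essential here: it makes the preimage of the compact set \<open>K\<close>
  closed in the whole manifold, so that the zero extension is smooth also at boundary points
  of \<open>U\<close>.\<close>
lemma smooth_functions_extend_by_zero:
  fixes u :: "real ^ 'd \<Rightarrow> real"
  assumes c: "(U, \<phi>) \<in> A" and u: "smooth_on UNIV u"
    and K: "compact K" "K \<subseteq> \<phi> ` U" "\<And>x. x \<notin> K \<Longrightarrow> u x = 0"
  shows "(\<lambda>q. if q \<in> U then u (\<phi> q) else 0) \<in> smooth_functions A" (is "?f \<in> _")
proof (rule smooth_functionsI, rule smooth_on_local)
  fix V \<psi> x assume c': "(V, \<psi>) \<in> A" and "x \<in> \<psi> ` V"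
  then obtain q where q: "q \<in> V" "x = \<psi> q" by blast
  show "\<exists>T. open T \<and> x \<in> T \<and> smooth_on T (\<lambda>x. ?f (inv_into V \<psi> x))"
  proof (cases "q \<in> U")
    case True
    have op: "open (\<psi> ` (V \<inter> U))"
      by (rule chart_image_open[OF c']) (auto intro: chart_facts(1)[OF c] chart_facts(1)[OF c'])
    have "smooth_on (\<psi> ` (V \<inter> U)) (\<lambda>x. u ((\<phi> \<circ> inv_into V \<psi>) x))"
      by (rule smooth_on_compose[OF op open_UNIV _ transition_smooth[OF c' c] u]) simp
    then have "smooth_on (\<psi> ` (V \<inter> U)) (\<lambda>x. ?f (inv_into V \<psi> x))"
      by (rule smooth_on_cong[OF op]) (auto simp: chart_inv[OF c'])
    with op q True show ?thesis by blast
  next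
    case False
    define L where "L = inv_into U \<phi> ` K"
    have "compact L" unfolding L_def
      by (rule compact_continuous_image[OF continuous_on_subset[OF homeomorphism_cont2[OF chart_facts(3)[OF c]] K(2)] K(1)])
    then have op: "open (\<psi> ` (V - L))"
      by (intro chart_image_open[OF c'] open_Diff chart_facts(1)[OF c'] compact_imp_closed) auto
    have "L \<subseteq> U" using K(2) by (auto simp: L_def inv_into_into subset_iff)
    then have "x \<in> \<psi> ` (V - L)" using False q by blast
    moreover have "?f (inv_into V \<psi> y) = 0" if "y \<in> \<psi> ` (V - L)" for y
    proof -
      from that obtain q' where q': "q' \<in> V" "q' \<notin> L" "y = \<psi> q'" by blast
      have "\<phi> q' \<notin> K" if "q' \<in> U" using chart_inv[OF c that] q'(2) by (force simp: L_def)
      then show ?thesis using q' by (simp add: chart_inv[OF c'] K(3))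
    qed
    then have "smooth_on (\<psi> ` (V - L)) (\<lambda>x. ?f (inv_into V \<psi> x))"
      by (intro smooth_on_cong[OF op smooth_on_const[of _ 0]]) auto
    ultimately show ?thesis using op by blast
  qed
qed

lemma tangent_linear:
  assumes "v \<in> tangent_space A p" "f \<in> smooth_functions A" "h \<in> smooth_functions A"
  shows "v (\<lambda>q. a * f q + b * h q) = a * v f + b * v h"
  using assms unfolding tangent_space_def by blast

lemma tangent_add:
  assumes "v \<in> tangent_space A p" "f \<in> smooth_functions A" "h \<in> smooth_functions A"
  shows "v (\<lambda>q. f q + h q) = v f + v h"
  using tangent_linear[OF assms, of 1 1] by simp

lemma tangent_mult:
  assumes "v \<in> tangent_space A p" "f \<in> smooth_functions A" "h \<in> smooth_functions A"
  shows "v (\<lambda>q. f q * h q) = f p * v h + h p * v f"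
  using assms unfolding tangent_space_def by blast

lemma tangent_nonsmooth:
  "v \<in> tangent_space A p \<Longrightarrow> f \<notin> smooth_functions A \<Longrightarrow> v f = 0"
  unfolding tangent_space_def by blast

lemma tangent_const:
  assumes "v \<in> tangent_space A p"
  shows "v (\<lambda>q. c) = 0"
proof -
  have "v (\<lambda>q. 1) = 0"
    using tangent_mult[OF assms smooth_functions_const[of 1] smooth_functions_const[of 1]] by simp
  then show ?thesis
    using tangent_linear[OF assms smooth_functions_const[of 1] smooth_functions_const[of 1], of c 0] by simp
qed

lemma tangent_sum:
  assumes "v \<in> tangent_space A p" "\<And>i. i \<in> I \<Longrightarrow> f i \<in> smooth_functions A" "finite I"
  shows "v (\<lambda>q. \<Sum>i\<in>I. f i q) = (\<Sum>i\<in>I. v (f i))"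
  using assms(3,2)
  by (induction I) (auto simp: tangent_const[OF assms(1)] tangent_add[OF assms(1)] smooth_functions_sum)

text \<open>The coordinate derivations of a chart, cut off by a bump function, are global smooth vector
  fields. That they form a basis at \<open>p\<close>, so that the space of derivations at \<open>p\<close> has the
  dimension of the manifold, is Hadamard's lemma.\<close>
lemma frame_exists: "\<exists>e. frame_at A p e"
proof -
  obtain U \<phi> where c: "(U, \<phi>) \<in> A" and p: "p \<in> U" by (rule chart_at)
  define a where "a = \<phi> p"
  note oU = chart_facts(2)[OF c]
  have "a \<in> \<phi> ` U" using p by (simp add: a_def)
  then obtain R where R: "R > 0" "ball a R \<subseteq> \<phi> ` U" using oU openE by blast
  define r where "r = R / 2"
  have r: "r > 0" "cball a r \<subseteq> ball a R" using R by (auto simp: r_def)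
  define \<eta> where "\<eta> = bump a r"
  have lift: "(\<lambda>q. if q \<in> U then \<eta> (\<phi> q) * h (\<phi> q) else 0) \<in> smooth_functions A"
    if "open W" "cball a r \<subseteq> W" "smooth_on W h" for h W
  proof (rule smooth_functions_extend_by_zero[OF c, where u = "\<lambda>x. \<eta> x * h x" and K = "cball a r"])
    show "smooth_on UNIV (\<lambda>x. \<eta> x * h x)" unfolding \<eta>_def by (rule smooth_on_bump_mult[OF r(1) that(2,1,3)])
    show "cball a r \<subseteq> \<phi> ` U" using r R by blast
    show "\<eta> x * h x = 0" if "x \<notin> cball a r" for x using bump_outside[OF r(1) that] by (simp add: \<eta>_def)
  qed simp
  have rU: "cball a r \<subseteq> \<phi> ` U" using r R by blast
  \<comment> \<open>\<open>loc f\<close> is \<open>f\<close> in the coordinates \<open>\<phi>\<close>, and \<open>\<delta> b f\<close> is its derivative in direction \<open>b\<close>.\<close>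
  define loc where "loc f x = (f (inv_into U \<phi> x) :: real)" for f x
  have loc: "smooth_on (\<phi> ` U) (loc f)" if "f \<in> smooth_functions A" for f
    unfolding loc_def[abs_def] using smooth_functionsD[OF that c] .
  have loc_eq: "loc f (\<phi> q) = f q" if "q \<in> U" for f q using chart_inv[OF c that] by (simp add: loc_def)
  define \<delta> where "\<delta> b f x = frechet_derivative (loc f) (at x) b" for b f x
  have \<delta>_eq: "\<delta> b f x = L b" if "(loc f has_derivative L) (at x)" for b f x L
    using frechet_derivative_at[OF that] by (simp add: \<delta>_def)
  have \<delta>: "(loc f has_derivative (\<lambda>b. \<delta> b f x)) (at x)" if "f \<in> smooth_functions A" "x \<in> \<phi> ` U" for f x
    unfolding \<delta>_def using smooth_on_has_derivative[OF loc[OF that(1)] that(2)] .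
  define E where "E b q f = (if f \<in> smooth_functions A \<and> q \<in> U then \<eta> (\<phi> q) * \<delta> b f (\<phi> q) else 0)" for b q f
  have Etan: "E b q \<in> tangent_space A q" for b q
  proof (cases "q \<in> U")
    case False
    then show ?thesis by (simp add: tangent_space_def E_def)
  next
    case True
    then have q: "\<phi> q \<in> \<phi> ` U" by blast
    show ?thesis
      unfolding tangent_space_def mem_Collect_eq
    proof (intro conjI allI impI ballI)
      fix f assume "f \<notin> smooth_functions A" then show "E b q f = 0" by (simp add: E_def)
    next
      fix f h s t assume fh: "f \<in> smooth_functions A" "h \<in> smooth_functions A"
      have "(loc (\<lambda>q. s * f q + t * h q) has_derivative (\<lambda>b. s * \<delta> b f (\<phi> q) + t * \<delta> b h (\<phi> q))) (at (\<phi> q))"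
        unfolding loc_def by (intro derivative_intros \<delta>[unfolded loc_def] fh q)
      from \<delta>_eq[OF this] show "E b q (\<lambda>q. s * f q + t * h q) = s * E b q f + t * E b q h"
        using fh by (simp add: E_def True smooth_functions_add smooth_functions_mult smooth_functions_const algebra_simps)
    next
      fix f h assume fh: "f \<in> smooth_functions A" "h \<in> smooth_functions A"
      have "(loc (\<lambda>q. f q * h q) has_derivative
          (\<lambda>b. loc f (\<phi> q) * \<delta> b h (\<phi> q) + \<delta> b f (\<phi> q) * loc h (\<phi> q))) (at (\<phi> q))"
        unfolding loc_def by (intro has_derivative_mult \<delta>[unfolded loc_def] fh q)
      from \<delta>_eq[OF this] show "E b q (\<lambda>q. f q * h q) = f q * E b q h + h q * E b q f"
        using fh by (simp add: E_def True smooth_functions_mult loc_eq algebra_simps)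
    qed
  qed
  have Evf: "E b \<in> vector_fields A" for b
    unfolding vector_fields_def mem_Collect_eq
  proof (intro conjI allI ballI Etan)
    fix f assume f: "f \<in> smooth_functions A"
    have "smooth_on (\<phi> ` U) (\<delta> b f)" unfolding \<delta>_def[abs_def] by (rule smooth_on_deriv[OF loc[OF f]])
    from lift[OF oU rU this] f show "(\<lambda>q. E b q f) \<in> smooth_functions A"
      by (simp add: E_def)
  qed
  \<comment> \<open>Coordinates centred at \<open>p\<close>, made global; their differentials at \<open>p\<close> are dual to the \<open>E b\<close>.\<close>
  define \<xi> where "\<xi> b q = (if q \<in> U then \<eta> (\<phi> q) * ((\<phi> q - a) \<bullet> b) else 0)" for b q
  have inner_deriv: "((\<lambda>x. (x - a) \<bullet> b) has_derivative (\<lambda>v. v \<bullet> b)) (at x)" for b x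
    by (auto intro!: derivative_eq_intros)
  have sm_inner: "smooth_on UNIV (\<lambda>x. (x - a) \<bullet> b)" for b
    using smooth_on_add[OF open_UNIV _ smooth_on_const, of "\<lambda>x. x \<bullet> b" "- (a \<bullet> b)"]
      Ck_on_bounded_linear[OF open_UNIV bounded_linear_inner_left]
    by (auto simp: inner_diff_left smooth_on_def)
  have \<xi>: "\<xi> b \<in> smooth_functions A" for b
    unfolding \<xi>_def[abs_def] by (rule lift[OF oU rU smooth_on_subset[OF sm_inner]]) simp
  have \<eta>a: "\<eta> a = 1" using bump_center[OF r(1)] by (simp add: \<eta>_def)
  have \<delta>\<xi>: "\<delta> c (\<xi> b) a = c \<bullet> b" for b c
  proof -
    have "((\<lambda>x. \<eta> x * ((x - a) \<bullet> b)) has_derivative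
        (\<lambda>v. \<eta> a * (v \<bullet> b) + frechet_derivative \<eta> (at a) v * ((a - a) \<bullet> b))) (at a)"
      unfolding \<eta>_def by (intro has_derivative_mult inner_deriv smooth_on_has_derivative[OF smooth_on_bump]) simp
    then have "((\<lambda>x. \<eta> x * ((x - a) \<bullet> b)) has_derivative (\<lambda>v. v \<bullet> b)) (at a)"
      by (simp add: \<eta>a)
    then have "(loc (\<xi> b) has_derivative (\<lambda>v. v \<bullet> b)) (at a)"
      by (rule has_derivative_transform_within_open[OF _ oU])
        (use p in \<open>auto simp: a_def loc_def \<xi>_def chart_inv[OF c]\<close>)
    then show ?thesis by (rule \<delta>_eq)
  qed
  have Ep: "E b p f = \<delta> b f a" if "f \<in> smooth_functions A" for b f
    using that p \<eta>a by (simp add: E_def a_def)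
  have expand: "v f = (\<Sum>b\<in>Basis. v (\<xi> b) * \<delta> b f a)"
    if v: "v \<in> tangent_space A p" and f: "f \<in> smooth_functions A" for v f
  proof -
    have "smooth_on (ball a R) (loc f)" by (rule smooth_on_subset[OF loc[OF f] R(2)])
    then obtain h where h: "\<And>b. smooth_on (ball a R) (h b)"
      "\<And>x. x \<in> ball a R \<Longrightarrow> loc f x = loc f a + (\<Sum>b\<in>Basis. ((x - a) \<bullet> b) * h b x)"
      "\<And>b. h b a = frechet_derivative (loc f) (at a) b"
      using hadamard[OF open_ball convex_ball, of a a R "loc f"] R(1) by auto
    \<comment> \<open>Hadamard's formula holds only near \<open>p\<close>. Multiplied by the square of the bump function it
      becomes an identity \<open>eq\<close> between global smooth functions, to which \<open>v\<close> can be applied; since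
      the bump function is \<open>1\<close> at \<open>p\<close> and \<open>f0\<close> vanishes there, the factors do not change \<open>v f0\<close>.\<close>
    define k where "k b q = (if q \<in> U then \<eta> (\<phi> q) * h b (\<phi> q) else 0)" for b q
    have k: "k b \<in> smooth_functions A" for b
      unfolding k_def[abs_def] by (rule lift[OF open_ball r(2) h(1)])
    define X where "X q = (if q \<in> U then \<eta> (\<phi> q) * 1 else 0)" for q
    have X: "X \<in> smooth_functions A"
      unfolding X_def[abs_def] by (rule lift[OF oU rU smooth_on_const])
    have Xp: "X p = 1" using p \<eta>a by (simp add: X_def a_def)
    define f0 where "f0 q = f q + (- f p)" for q
    have f0: "f0 \<in> smooth_functions A" "v f0 = v f" "f0 p = 0"
      unfolding f0_def[abs_def]
      using smooth_functions_add[OF f smooth_functions_const[of "- f p"]]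
        tangent_add[OF v f smooth_functions_const[of "- f p"]] tangent_const[OF v, of "- f p"] by simp_all
    have Xf: "(\<lambda>q. X q * f0 q) \<in> smooth_functions A" by (rule smooth_functions_mult[OF X f0(1)])
    have eq: "X q * (X q * f0 q) = (\<Sum>b\<in>Basis. \<xi> b q * k b q)" for q
    proof (cases "q \<in> U \<and> \<phi> q \<in> ball a R")
      case True
      then have "f0 q = (\<Sum>b\<in>Basis. ((\<phi> q - a) \<bullet> b) * h b (\<phi> q))"
        using h(2)[of "\<phi> q"] loc_eq[of q f] loc_eq[OF p, of f] by (simp add: f0_def a_def)
      then show ?thesis using True by (simp add: X_def \<xi>_def k_def sum_distrib_left ac_simps)
    next
      case False
      then have "q \<in> U \<Longrightarrow> \<eta> (\<phi> q) = 0"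
        unfolding \<eta>_def using r by (intro bump_outside) auto
      then show ?thesis by (auto simp: X_def \<xi>_def k_def)
    qed
    have "v f = v (\<lambda>q. X q * (X q * f0 q))"
      using tangent_mult[OF v X Xf] tangent_mult[OF v X f0(1)] f0 Xp by simp
    also have "\<dots> = v (\<lambda>q. \<Sum>b\<in>Basis. \<xi> b q * k b q)" by (simp only: eq)
    also have "\<dots> = (\<Sum>b\<in>Basis. v (\<lambda>q. \<xi> b q * k b q))"
      by (rule tangent_sum[OF v]) (auto intro: smooth_functions_mult \<xi> k)
    also have "\<dots> = (\<Sum>b\<in>Basis. v (\<xi> b) * \<delta> b f a)"
    proof (rule sum.cong[OF refl])
      fix b
      have "\<xi> b p = 0" "k b p = \<delta> b f a" using p \<eta>a h(3) by (simp_all add: \<xi>_def k_def a_def[symmetric] \<delta>_def)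
      then show "v (\<lambda>q. \<xi> b q * k b q) = v (\<xi> b) * \<delta> b f a" by (simp add: tangent_mult[OF v \<xi> k])
    qed
    finally show ?thesis .
  qed
  have "tangent_basis A p (\<lambda>i. E (axis i 1) p)"
    unfolding tangent_basis_def
  proof (intro conjI allI ballI Etan)
    fix v assume v: "v \<in> tangent_space A p"
    show "\<exists>!c::real^'d. v = (\<lambda>f. \<Sum>i\<in>UNIV. c $ i * E (axis i 1) p f)"
    proof (rule ex1I)
      show "v = (\<lambda>f. \<Sum>i\<in>UNIV. (\<chi> i. v (\<xi> (axis i 1))) $ i * E (axis i 1) p f)"
      proof
        fix f
        show "v f = (\<Sum>i\<in>UNIV. (\<chi> i. v (\<xi> (axis i 1))) $ i * E (axis i 1) p f)"
        proof (cases "f \<in> smooth_functions A")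
          case True
          then show ?thesis using expand[OF v True] by (simp add: sum_Basis_axis Ep)
        next
          case False
          then show ?thesis using tangent_nonsmooth[OF v False] by (simp add: E_def)
        qed
      qed
    next
      fix c :: "real^'d" assume vc: "v = (\<lambda>f. \<Sum>i\<in>UNIV. c $ i * E (axis i 1) p f)"
      have "v (\<xi> (axis j 1)) = c $ j" for j
        unfolding vc by (simp add: Ep[OF \<xi>] \<delta>\<xi> inner_axis_axis if_distrib if_distribR cong: if_cong)
      then show "c = (\<chi> i. v (\<xi> (axis i 1)))" by (simp add: vec_eq_iff)
    qed
  qed
  then show ?thesis using Evf by (intro exI[of _ "\<lambda>i. E (axis i 1)"]) (simp add: frame_at_def)
qed

end

section \<open>Vector fields, the metric and traces\<close>

text \<open>The difference \<open>N - N'\<close>, which is a tensor field of type \<open>(1,2)\<close> when both arguments are linear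
  connections.\<close>
definition connection_difference :: "'m conn \<Rightarrow> 'm conn \<Rightarrow> 'm vfield \<Rightarrow> 'm vfield \<Rightarrow> 'm vfield" where
  "connection_difference N N' X Y = vf_diff (N X Y) (N' X Y)"

context
  fixes A :: "('m::{t2_space,second_countable_topology}, 'd::finite) chart set"
  assumes atlas: "smooth_atlas A"
begin

lemma tangent_space_comb:
  assumes "u \<in> tangent_space A p" "v \<in> tangent_space A p"
  shows "(\<lambda>f. a * u f + b * v f) \<in> tangent_space A p"
  using assms unfolding tangent_space_def by (auto simp: algebra_simps)

lemma tangent_space_zero: "(\<lambda>f. 0) \<in> tangent_space A p"
  by (simp add: tangent_space_def)

lemma tangent_space_sum:
  assumes "finite I" "\<And>i. i \<in> I \<Longrightarrow> b i \<in> tangent_space A p"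
  shows "(\<lambda>f. \<Sum>i\<in>I. c i * b i f) \<in> tangent_space A p"
  using assms
proof (induction I)
  case empty
  then show ?case by (simp add: tangent_space_zero)
next
  case (insert i I)
  then show ?case using tangent_space_comb[of "b i" p "\<lambda>f. \<Sum>i\<in>I. c i * b i f" "c i" 1] by simp
qed

lemma vector_fields_at: "X \<in> vector_fields A \<Longrightarrow> X p \<in> tangent_space A p"
  by (simp add: vector_fields_def)

lemma vf_scale_in: 
  assumes "h \<in> smooth_functions A" "X \<in> vector_fields A"
  shows "vf_scale h X \<in> vector_fields A"
  using assms tangent_space_comb[OF vector_fields_at[OF assms(2)] tangent_space_zero, where b = 0]
  by (simp add: vector_fields_def vf_scale_def smooth_functions_mult[OF atlas])

lemma vf_add_in:
  assumes "X \<in> vector_fields A" "Y \<in> vector_fields A"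
  shows "vf_add X Y \<in> vector_fields A"
  using assms tangent_space_comb[OF vector_fields_at[OF assms(1)] vector_fields_at[OF assms(2)], where a = 1 and b = 1]
  by (simp add: vector_fields_def vf_add_def smooth_functions_add[OF atlas])

lemma vf_diff_in:
  assumes "X \<in> vector_fields A" "Y \<in> vector_fields A"
  shows "vf_diff X Y \<in> vector_fields A"
proof -
  have "vf_diff X Y = vf_add X (vf_scale (\<lambda>_. -1) Y)"
    by (simp add: vf_diff_def vf_add_def vf_scale_def)
  then show ?thesis using assms by (simp add: vf_add_in vf_scale_in smooth_functions_const[OF atlas])
qed

lemma some_frame_is_frame: "frame_at A p (some_frame A p)"
  unfolding some_frame_def using frame_exists[OF atlas] by (rule someI_ex)

context
  fixes g :: "'m metric"
  assumes metric: "riemannian_metric A g"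
begin

lemma metric_sym: "u \<in> tangent_space A p \<Longrightarrow> v \<in> tangent_space A p \<Longrightarrow> g p u v = g p v u"
  using metric unfolding riemannian_metric_def by blast

lemma metric_pos: "u \<in> tangent_space A p \<Longrightarrow> u \<noteq> (\<lambda>f. 0) \<Longrightarrow> g p u u > 0"
  using metric unfolding riemannian_metric_def by blast

lemma metric_comb:
  "u \<in> tangent_space A p \<Longrightarrow> v \<in> tangent_space A p \<Longrightarrow> w \<in> tangent_space A p \<Longrightarrow>
    g p (\<lambda>f. a * u f + b * v f) w = a * g p u w + b * g p v w"
  using metric unfolding riemannian_metric_def by blast

lemma metric_zero: "w \<in> tangent_space A p \<Longrightarrow> g p (\<lambda>f. 0) w = 0"
  using metric_comb[of w p w w 0 0] by simp

lemma metric_sum: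
  assumes "finite I" "\<And>i. i \<in> I \<Longrightarrow> b i \<in> tangent_space A p" "w \<in> tangent_space A p"
  shows "g p (\<lambda>f. \<Sum>i\<in>I. c i * b i f) w = (\<Sum>i\<in>I. c i * g p (b i) w)"
  using assms(1,2)
proof (induction I)
  case empty
  then show ?case by (simp add: metric_zero assms)
next
  case (insert i I)
  then show ?case
    using metric_comb[of "b i" p "\<lambda>f. \<Sum>i\<in>I. c i * b i f" w "c i" 1] assms(3)
    by (simp add: tangent_space_sum)
qed

lemma gf_sym: "X \<in> vector_fields A \<Longrightarrow> Y \<in> vector_fields A \<Longrightarrow> gf g X Y p = gf g Y X p"
  unfolding gf_def by (intro metric_sym vector_fields_at)

lemma gf_add:
  "X \<in> vector_fields A \<Longrightarrow> Y \<in> vector_fields A \<Longrightarrow> Z \<in> vector_fields A \<Longrightarrow>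
    gf g (vf_add X Y) Z p = gf g X Z p + gf g Y Z p"
  unfolding gf_def vf_add_def
  using metric_comb[of "X p" p "Y p" "Z p" 1 1] by (simp add: vector_fields_at)

lemma gf_diff:
  "X \<in> vector_fields A \<Longrightarrow> Y \<in> vector_fields A \<Longrightarrow> Z \<in> vector_fields A \<Longrightarrow>
    gf g (vf_diff X Y) Z p = gf g X Z p - gf g Y Z p"
  unfolding gf_def vf_diff_def
  using metric_comb[of "X p" p "Y p" "Z p" 1 "-1"] by (simp add: vector_fields_at)

lemma gf_scale:
  "X \<in> vector_fields A \<Longrightarrow> Z \<in> vector_fields A \<Longrightarrow> gf g (vf_scale h X) Z p = h p * gf g X Z p"
  unfolding gf_def vf_scale_def
  using metric_comb[of "X p" p "X p" "Z p" "h p" 0] by (simp add: vector_fields_at)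

lemma gf_diff_right:
  "X \<in> vector_fields A \<Longrightarrow> Y \<in> vector_fields A \<Longrightarrow> Z \<in> vector_fields A \<Longrightarrow>
    gf g Z (vf_diff X Y) p = gf g Z X p - gf g Z Y p"
  using gf_diff[of X Y Z p] gf_sym[of Z _ p] vf_diff_in by simp

lemma gram_invertible:
  fixes e :: "'d \<Rightarrow> 'm vfield"
  assumes "frame_at A p e"
  shows "invertible (\<chi> i j. gf g (e i) (e j) p :: real^'d^'d)"
proof -
  let ?G = "\<chi> i j. gf g (e i) (e j) p :: real^'d^'d"
  have e: "e i p \<in> tangent_space A p" for i using assms by (simp add: frame_at_def vector_fields_at)
  have "x = 0" if x: "?G *v x = 0" for x
  proof -
    define w where "w = (\<lambda>f. \<Sum>i\<in>UNIV. x $ i * e i p f)"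
    have w: "w \<in> tangent_space A p" unfolding w_def by (rule tangent_space_sum) (auto simp: e)
    have "g p (e i p) w = 0" for i
    proof -
      have "g p (e i p) w = (\<Sum>j\<in>UNIV. x $ j * g p (e j p) (e i p))"
        unfolding metric_sym[OF e w] unfolding w_def by (rule metric_sum) (auto simp: e)
      also have "\<dots> = (?G *v x) $ i"
        by (simp add: matrix_vector_mult_def gf_def mult.commute metric_sym[OF e e, of i])
      finally show ?thesis using x by simp
    qed
    then have "g p w w = 0"
      using metric_sum[of UNIV "\<lambda>i. e i p" p w "\<lambda>i. x $ i"] w e by (simp add: w_def[symmetric])
    then have w0: "w = (\<lambda>f. 0)" using metric_pos[OF w] by fastforce
    have "\<exists>!c::real^'d. w = (\<lambda>f. \<Sum>i\<in>UNIV. c $ i * e i p f)"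
      using assms w by (simp add: frame_at_def tangent_basis_def)
    moreover have "w = (\<lambda>f. \<Sum>i\<in>UNIV. (0::real^'d) $ i * e i p f)" using w0 by simp
    ultimately show "x = 0" using w_def by blast
  qed
  then show ?thesis
    using matrix_left_invertible_ker[of ?G] invertible_left_inverse[of ?G] by blast
qed

text \<open>The scalar curvature of \<open>\<pi>\<^sub>1\<close> is \<open>m (m - 1)\<close> in dimension \<open>m\<close>. The coefficient \<open>c\<close> may depend on
  the point \<open>p\<close>.\<close>
lemma scal_add_pi1:
  assumes L: "\<And>X Y Z W. X \<in> vector_fields A \<Longrightarrow> Y \<in> vector_fields A \<Longrightarrow> Z \<in> vector_fields A \<Longrightarrow>
     W \<in> vector_fields A \<Longrightarrow> L' X Y Z W p = L X Y Z W p + c * pi1 g X Y Z W p"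
  shows "scal A g L' p = scal A g L p + c * (real CARD('d) * (real CARD('d) - 1))"
proof -
  define e where "e = some_frame A p"
  have fr: "frame_at A p e" unfolding e_def by (rule some_frame_is_frame)
  then have e: "e i \<in> vector_fields A" for i by (simp add: frame_at_def)
  define G :: "real^'d^'d" where "G = (\<chi> i j. gf g (e i) (e j) p)"
  define H where "H = matrix_inv G"
  have contr: "contract A g B p = (\<Sum>i\<in>UNIV. \<Sum>j\<in>UNIV. H $ i $ j * B (e i) (e j) p)" for B
    by (simp add: contract_def Let_def e_def H_def G_def)
  have sym: "G $ i $ j = G $ j $ i" for i j by (simp add: G_def gf_sym[OF e e])
  have "H ** G = mat 1"
    using someI_ex[OF gram_invertible[OF fr, unfolded invertible_def]]
    by (simp add: H_def G_def matrix_inv_def)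
  then have HG: "(\<Sum>j\<in>UNIV. H $ i $ j * G $ j $ k) = (if i = k then 1 else 0)" for i k
    by (simp add: matrix_matrix_mult_def mat_def vec_eq_iff)
  have trace: "(\<Sum>i\<in>UNIV. \<Sum>j\<in>UNIV. H $ i $ j * G $ i $ j) = real CARD('d)"
    by (subst sym) (simp add: HG)
  have swap: "(\<Sum>i\<in>UNIV. \<Sum>j\<in>UNIV. H $ i $ j * (G $ i $ l * G $ k $ j)) = G $ k $ l" for k l
  proof -
    have "(\<Sum>i\<in>UNIV. \<Sum>j\<in>UNIV. H $ i $ j * (G $ i $ l * G $ k $ j)) =
        (\<Sum>i\<in>UNIV. G $ i $ l * (\<Sum>j\<in>UNIV. H $ i $ j * G $ j $ k))"
      by (subst (2) sym) (simp add: sum_distrib_left ac_simps)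
    then show ?thesis by (simp add: HG if_distrib cong: if_cong)
  qed
  have "ricci A g L' (e k) (e l) p = ricci A g L (e k) (e l) p + c * (real CARD('d) - 1) * G $ k $ l" for k l
  proof -
    have "ricci A g L' (e k) (e l) p = ricci A g L (e k) (e l) p +
       (\<Sum>i\<in>UNIV. \<Sum>j\<in>UNIV. H $ i $ j * (c * (G $ k $ l * G $ i $ j - G $ i $ l * G $ k $ j)))"
      by (simp add: ricci_def contr L e pi1_def G_def distrib_left sum.distrib)
    also have "(\<Sum>i\<in>UNIV. \<Sum>j\<in>UNIV. H $ i $ j * (c * (G $ k $ l * G $ i $ j - G $ i $ l * G $ k $ j))) =
      c * (G $ k $ l * (\<Sum>i\<in>UNIV. \<Sum>j\<in>UNIV. H $ i $ j * G $ i $ j) -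
        (\<Sum>i\<in>UNIV. \<Sum>j\<in>UNIV. H $ i $ j * (G $ i $ l * G $ k $ j)))"
      by (simp add: sum_distrib_left right_diff_distrib sum_subtractf ac_simps)
    finally show ?thesis unfolding trace swap by (simp add: algebra_simps)
  qed
  then have "scal A g L' p = scal A g L p +
      (\<Sum>i\<in>UNIV. \<Sum>j\<in>UNIV. H $ i $ j * (c * (real CARD('d) - 1) * G $ i $ j))"
    by (simp add: scal_def contr distrib_left sum.distrib)
  also have "(\<Sum>i\<in>UNIV. \<Sum>j\<in>UNIV. H $ i $ j * (c * (real CARD('d) - 1) * G $ i $ j)) =
      c * (real CARD('d) - 1) * (\<Sum>i\<in>UNIV. \<Sum>j\<in>UNIV. H $ i $ j * G $ i $ j)"
    by (simp add: sum_distrib_left ac_simps)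
  finally show ?thesis unfolding trace by (simp add: algebra_simps)
qed

section \<open>Metric connections with parallel vectorial torsion\<close>

text \<open>\<open>D\<close> is a metric connection with torsion \<open>T(X,Y) = \<alpha>(X) Y - \<alpha>(Y) X\<close>. Apart from this
  formula \<open>\<alpha>\<close> is an arbitrary map from vector fields to functions: its linearity and its dependence
  on the value of the field at a point follow
  (see \<open>dual_field\<close>), and its smoothness is never used.\<close>

context
  fixes nabla D :: "'m conn" and \<alpha> :: "'m vfield \<Rightarrow> 'm \<Rightarrow> real"
  assumes LC: "levi_civita A g nabla"
    and D: "linear_connection A D" "parallel_metric A D g"
    and T: "\<And>X Y Z p. X \<in> vector_fields A \<Longrightarrow> Y \<in> vector_fields A \<Longrightarrow> Z \<in> vector_fields A \<Longrightarrow>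
       gf g (torsion D X Y) Z p = gf g Y Z p * \<alpha> X p - gf g X Z p * \<alpha> Y p"
    and par: "parallel_torsion A D"
begin

abbreviation S where "S \<equiv> connection_difference D nabla"

lemma nabla_in: "X \<in> vector_fields A \<Longrightarrow> Y \<in> vector_fields A \<Longrightarrow> nabla X Y \<in> vector_fields A"
  using LC by (simp add: levi_civita_def linear_connection_def)

lemma D_in: "X \<in> vector_fields A \<Longrightarrow> Y \<in> vector_fields A \<Longrightarrow> D X Y \<in> vector_fields A"
  using D by (simp add: linear_connection_def)

lemma S_in: "X \<in> vector_fields A \<Longrightarrow> Y \<in> vector_fields A \<Longrightarrow> S X Y \<in> vector_fields A"
  by (simp add: connection_difference_def vf_diff_in nabla_in D_in)

lemma lie_bracket_eq:
  assumes "X \<in> vector_fields A" "Y \<in> vector_fields A"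
  shows "lie_bracket X Y = vf_diff (nabla X Y) (nabla Y X)"
proof -
  have "torsion nabla X Y = vf_zero" using LC assms by (simp add: levi_civita_def)
  then show ?thesis by (auto simp: torsion_def vf_diff_def vf_zero_def fun_eq_iff)
qed

lemma lie_bracket_in: "X \<in> vector_fields A \<Longrightarrow> Y \<in> vector_fields A \<Longrightarrow> lie_bracket X Y \<in> vector_fields A"
  by (simp add: lie_bracket_eq vf_diff_in nabla_in)

lemma torsion_in: "X \<in> vector_fields A \<Longrightarrow> Y \<in> vector_fields A \<Longrightarrow> torsion D X Y \<in> vector_fields A"
  by (simp add: torsion_def vf_diff_in D_in lie_bracket_in)

lemma torsion_eq:
  "X \<in> vector_fields A \<Longrightarrow> Y \<in> vector_fields A \<Longrightarrow> torsion D X Y = vf_diff (S X Y) (S Y X)"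
  by (simp add: torsion_def lie_bracket_eq connection_difference_def vf_diff_def algebra_simps)

lemmas vf_in = nabla_in D_in S_in lie_bracket_in torsion_in vf_diff_in vf_add_in

lemma parallel_D:
  "X \<in> vector_fields A \<Longrightarrow> Y \<in> vector_fields A \<Longrightarrow> Z \<in> vector_fields A \<Longrightarrow>
    vf_act X (gf g Y Z) p = gf g (D X Y) Z p + gf g Y (D X Z) p"
  using D(2) unfolding parallel_metric_def by (simp add: algebra_simps)

lemma parallel_nabla:
  "X \<in> vector_fields A \<Longrightarrow> Y \<in> vector_fields A \<Longrightarrow> Z \<in> vector_fields A \<Longrightarrow>
    vf_act X (gf g Y Z) p = gf g (nabla X Y) Z p + gf g Y (nabla X Z) p"
  using LC unfolding levi_civita_def parallel_metric_def by (simp add: algebra_simps)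

text \<open>The usual Koszul argument: a tensor that is skew in its last two arguments is determined by
  its skew part in the first two.\<close>
lemma S_formula:
  assumes "X \<in> vector_fields A" "Y \<in> vector_fields A" "Z \<in> vector_fields A"
  shows "gf g (S X Y) Z p = gf g X Y p * \<alpha> Z p - gf g X Z p * \<alpha> Y p"
proof -
  have skew: "gf g (S X Y) Z p = - gf g (S X Z) Y p"
    if "X \<in> vector_fields A" "Y \<in> vector_fields A" "Z \<in> vector_fields A" for X Y Z
    using parallel_D[OF that, of p] parallel_nabla[OF that, of p] that
    by (simp add: connection_difference_def gf_diff vf_in gf_sym[of Y])
  have tor: "gf g (S X Y) Z p - gf g (S Y X) Z p = gf g Y Z p * \<alpha> X p - gf g X Z p * \<alpha> Y p"
    if "X \<in> vector_fields A" "Y \<in> vector_fields A" "Z \<in> vector_fields A" for X Y Z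
    using T[OF that, of p] that by (simp add: torsion_eq gf_diff vf_in)
  show ?thesis
    using skew[of X Y Z] skew[of Y Z X] skew[of Z X Y] tor[of X Y Z] tor[of Y Z X] tor[of Z X Y] assms
      gf_sym[of X Y p] gf_sym[of Y Z p] gf_sym[of X Z p]
    by simp
qed

text \<open>The difference tensor is the torsion with its arguments permuted, so it is
  parallel along with the torsion.\<close>
lemma torsion_S:
  assumes "X \<in> vector_fields A" "Y \<in> vector_fields A" "Z \<in> vector_fields A"
  shows "gf g (torsion D X Y) Z p = gf g (S Z Y) X p"
  using T[OF assms] S_formula[of Z Y X p] assms gf_sym[of Z _ p] by simp

lemma S_parallel:
  assumes v: "X \<in> vector_fields A" "Y \<in> vector_fields A" "Z \<in> vector_fields A" "W \<in> vector_fields A"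
  shows "gf g (D X (S Y Z)) W p = gf g (S (D X Y) Z) W p + gf g (S Y (D X Z)) W p"
proof -
  have eq: "gf g (S Y Z) W = gf g (torsion D W Z) Y"
    using torsion_S v by (auto simp: fun_eq_iff)
  have "vf_diff (vf_diff (D X (torsion D W Z)) (torsion D (D X W) Z)) (torsion D W (D X Z)) = vf_zero"
    using par v unfolding parallel_torsion_def by blast
  then have "D X (torsion D W Z) = vf_add (torsion D (D X W) Z) (torsion D W (D X Z))"
    by (auto simp: vf_diff_def vf_add_def vf_zero_def fun_eq_iff algebra_simps)
  then have "gf g (D X (torsion D W Z)) Y p = gf g (S Y Z) (D X W) p + gf g (S Y (D X Z)) W p"
    using v by (simp add: gf_add vf_in torsion_S)
  moreover have "gf g (torsion D W Z) (D X Y) p = gf g (S (D X Y) Z) W p"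
    using v by (simp add: torsion_S vf_in)
  ultimately show ?thesis
    using parallel_D[of X "S Y Z" W p] parallel_D[of X "torsion D W Z" Y p] v
    by (simp add: eq vf_in)
qed

text \<open>The vector dual to \<open>\<alpha>\<close> at the point \<open>p\<close>: for \<open>E p \<noteq> 0\<close>, the formula for \<open>S\<close> gives
  \<open>S(E,E) + \<alpha>(E) E = g(E,E) \<alpha>\<^sup>\<sharp>\<close>. The coefficients are taken constant, equal to their values
  at \<open>p\<close>, so that \<open>a\<close> is a smooth field although duality is claimed at \<open>p\<close> only.\<close>
lemma dual_field:
  obtains a where "a \<in> vector_fields A" "\<And>Z. Z \<in> vector_fields A \<Longrightarrow> \<alpha> Z p = gf g a Z p"
proof -
  obtain e :: "'d \<Rightarrow> 'm vfield" where fr: "frame_at A p e" using some_frame_is_frame by blast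
  define E where "E = e undefined"
  have E: "E \<in> vector_fields A" using fr by (simp add: E_def frame_at_def)
  have "E p \<noteq> (\<lambda>f. 0)"
  proof
    assume E0: "E p = (\<lambda>f. 0)"
    have "\<exists>!c::real^'d. (\<lambda>f. 0) = (\<lambda>f. \<Sum>i\<in>UNIV. c $ i * e i p f)"
      using fr tangent_space_zero by (simp add: frame_at_def tangent_basis_def)
    moreover have "(\<lambda>f. 0) = (\<lambda>f. \<Sum>i\<in>UNIV. (0::real^'d) $ i * e i p f)" by simp
    moreover have "(\<lambda>f. 0) = (\<lambda>f. \<Sum>i\<in>UNIV. axis undefined (1::real) $ i * e i p f)"
      using E0 by (simp add: E_def axis_def if_distribR if_distrib cong: if_cong)
    ultimately have "(0::real^'d) = axis undefined 1" by blast
    then show False by (simp add: axis_eq_0_iff)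
  qed
  then have pos: "gf g E E p > 0"
    unfolding gf_def by (rule metric_pos[OF vector_fields_at[OF E]])
  define a where "a = vf_scale (\<lambda>_. 1 / gf g E E p) (vf_add (S E E) (vf_scale (\<lambda>_. \<alpha> E p) E))"
  have "\<alpha> Z p = gf g a Z p" if Z: "Z \<in> vector_fields A" for Z
    using E Z pos
    by (simp add: a_def gf_scale gf_add vf_in vf_scale_in smooth_functions_const[OF atlas] S_formula field_simps)
  moreover have "a \<in> vector_fields A"
    unfolding a_def using E by (simp add: vf_in vf_scale_in smooth_functions_const[OF atlas])
  ultimately show ?thesis using that by blast
qed

text \<open>For \<open>\<nabla> = D - S\<close> with \<open>D S = 0\<close> all derivatives of \<open>S\<close> drop out of the curvature, and
  \<open>R(X,Y) Z = R'(X,Y) Z + S(X, S(Y,Z)) - S(Y, S(X,Z)) - S(T(X,Y), Z)\<close>.\<close>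
lemma curvature_relation:
  assumes v: "X \<in> vector_fields A" "Y \<in> vector_fields A" "Z \<in> vector_fields A" "W \<in> vector_fields A"
  shows "gf g (curvature nabla X Y Z) W p = gf g (curvature D X Y Z) W p
     + gf g (S X (S Y Z)) W p - gf g (S Y (S X Z)) W p - gf g (S (torsion D X Y) Z) W p"
proof -
  obtain a where a: "a \<in> vector_fields A" "\<And>Z. Z \<in> vector_fields A \<Longrightarrow> \<alpha> Z p = gf g a Z p"
    by (rule dual_field) blast
  have nab: "gf g (nabla U V) W p = gf g (D U V) W p - gf g (S U V) W p"
    if "U \<in> vector_fields A" "V \<in> vector_fields A" for U V
    using that v by (simp add: connection_difference_def gf_diff vf_in)
  have nab2: "gf g (nabla U (nabla V Z)) W p = gf g (D U (D V Z)) W p - gf g (S (D U V) Z) W p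
      - gf g (S V (D U Z)) W p - gf g (S U (D V Z)) W p + gf g (S U (S V Z)) W p"
    if u: "U \<in> vector_fields A" "V \<in> vector_fields A" for U V
  proof -
    have "D V Z = vf_add (nabla V Z) (S V Z)" by (simp add: connection_difference_def vf_diff_def vf_add_def)
    then have "D U (D V Z) = vf_add (D U (nabla V Z)) (D U (S V Z))"
      using D(1) u v vf_in by (simp add: linear_connection_def)
    then have "gf g (D U (D V Z)) W p = gf g (D U (nabla V Z)) W p + gf g (D U (S V Z)) W p"
      using u v by (simp add: gf_add vf_in)
    moreover have "gf g (S U (S V Z)) W p = gf g (S U (D V Z)) W p - gf g (S U (nabla V Z)) W p"
      using u v a
      by (simp add: S_formula vf_in) (simp add: connection_difference_def gf_diff_right vf_in algebra_simps)
    ultimately show ?thesis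
      using nab[of U "nabla V Z"] u v by (simp add: vf_in S_parallel)
  qed
  have "lie_bracket X Y = vf_diff (vf_diff (D X Y) (D Y X)) (torsion D X Y)"
    by (simp add: torsion_def vf_diff_def)
  then have "gf g (S (lie_bracket X Y) Z) W p =
      gf g (S (D X Y) Z) W p - gf g (S (D Y X) Z) W p - gf g (S (torsion D X Y) Z) W p"
    using v by (simp add: S_formula vf_in gf_diff algebra_simps)
  then show ?thesis
    using v nab[of "lie_bracket X Y" Z] nab2[of X Y] nab2[of Y X]
    by (simp add: curvature_def gf_diff vf_in)
qed

text \<open>Inserting the formula for \<open>S\<close>, all terms cancel except those with \<open>\<alpha>(a) = |\<alpha>|\<^sup>2\<close>.\<close>
lemma curvature_D:
  obtains c where "\<And>X Y Z W. X \<in> vector_fields A \<Longrightarrow> Y \<in> vector_fields A \<Longrightarrow> Z \<in> vector_fields A \<Longrightarrow>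
     W \<in> vector_fields A \<Longrightarrow> curvature4 g D X Y Z W p = curvature4 g nabla X Y Z W p + c * pi1 g X Y Z W p"
proof -
  obtain a where a: "a \<in> vector_fields A" "\<And>Z. Z \<in> vector_fields A \<Longrightarrow> \<alpha> Z p = gf g a Z p"
    by (rule dual_field) blast
  have "curvature4 g D X Y Z W p = curvature4 g nabla X Y Z W p + \<alpha> a p * pi1 g X Y Z W p"
    if v: "X \<in> vector_fields A" "Y \<in> vector_fields A" "Z \<in> vector_fields A" "W \<in> vector_fields A" for X Y Z W
  proof -
    have aS: "\<alpha> (S U V) p = gf g U V p * \<alpha> a p - \<alpha> U p * \<alpha> V p"
      if "U \<in> vector_fields A" "V \<in> vector_fields A" for U V
      using a(2)[of "S U V"] a(2)[of U] that a(1) S_formula[of U V a p] gf_sym[of a _ p]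
      by (simp add: vf_in)
    have SS: "gf g (S U (S V Z)) W p = (gf g V Z p * \<alpha> U p - gf g U V p * \<alpha> Z p) * \<alpha> W p
        - gf g U W p * (gf g V Z p * \<alpha> a p - \<alpha> V p * \<alpha> Z p)"
      if u: "U \<in> vector_fields A" "V \<in> vector_fields A" for U V
      using S_formula[of U "S V Z" W p] S_formula[of V Z U p] gf_sym[of U "S V Z" p] gf_sym[of U V p] aS[of V Z] u v
      by (simp add: vf_in)
    have ST: "gf g (S (torsion D X Y) Z) W p = (gf g Y Z p * \<alpha> X p - gf g X Z p * \<alpha> Y p) * \<alpha> W p
        - (gf g Y W p * \<alpha> X p - gf g X W p * \<alpha> Y p) * \<alpha> Z p"
      using S_formula[of "torsion D X Y" Z W p] v by (simp add: T vf_in)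
    show ?thesis
      unfolding curvature4_def pi1_def curvature_relation[OF v] SS[OF v(1,2)] SS[OF v(2,1)] ST gf_sym[OF v(2,1)]
      by (simp add: algebra_simps)
  qed
  then show ?thesis using that by blast
qed

end
end
end

section \<open>Equality of the tensors \<open>E\<close>\<close>

theorem theorem6p1:
  fixes A :: "('m::{t2_space,second_countable_topology}, 'd::finite) chart set"
    and P :: "'m endo" and g :: "'m metric"
    and nabla D :: "'m conn"
    and n :: nat
  assumes "almost_product_manifold A P g"
    and "CARD('d) = 2 * n"
    and "\<forall>p. endo_trace A P p = 0"
    and "levi_civita A g nabla"
    and "class_W3 n A P g nabla \<or> class_W6 n A P g nabla"
    and "closed_form A (assoc_form A g P nabla)"
    and "connection_D n A P g nabla D"
    and "parallel_torsion A D"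
  shows "\<forall>X\<in>vector_fields A. \<forall>Y\<in>vector_fields A. \<forall>Z\<in>vector_fields A. \<forall>W\<in>vector_fields A. \<forall>p.
           E_tensor n A g (curvature4 g D) X Y Z W p = E_tensor n A g (curvature4 g nabla) X Y Z W p"
proof (intro ballI allI)
  fix X Y Z W p
  assume v: "X \<in> vector_fields A" "Y \<in> vector_fields A" "Z \<in> vector_fields A" "W \<in> vector_fields A"
  have M: "smooth_atlas A" "riemannian_metric A g"
    using assms(1) by (auto simp: almost_product_manifold_def)
  have D: "linear_connection A D" "parallel_metric A D g"
    using assms(7) by (auto simp: connection_D_def natural_connection_def)
  define \<alpha> where "\<alpha> X p = assoc_form A g P nabla (ef P X) p / (2 * real n)" for X p
  have T: "gf g (torsion D X Y) Z p = gf g Y Z p * \<alpha> X p - gf g X Z p * \<alpha> Y p"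
    if "X \<in> vector_fields A" "Y \<in> vector_fields A" "Z \<in> vector_fields A" for X Y Z p
    using assms(7) that by (simp add: connection_D_def Let_def \<alpha>_def diff_divide_distrib)
  obtain c where c: "\<And>X Y Z W. X \<in> vector_fields A \<Longrightarrow> Y \<in> vector_fields A \<Longrightarrow> Z \<in> vector_fields A \<Longrightarrow>
     W \<in> vector_fields A \<Longrightarrow> curvature4 g D X Y Z W p = curvature4 g nabla X Y Z W p + c * pi1 g X Y Z W p"
    using curvature_D[OF M assms(4) D T assms(8), of p] by blast
  have dim: "real CARD('d) = 2 * real n" using assms(2) by simp
  have scal: "scal A g (curvature4 g D) p =
      scal A g (curvature4 g nabla) p + c * (real CARD('d) * (real CARD('d) - 1))"
    by (rule scal_add_pi1[OF M]) (rule c)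
  have "n > 0" using assms(2) zero_less_card_finite[where 'a='d] by linarith
  then have "2 * real n * (2 * real n - 1) \<noteq> 0" by (auto simp: field_simps) 
  then show "E_tensor n A g (curvature4 g D) X Y Z W p = E_tensor n A g (curvature4 g nabla) X Y Z W p"
    unfolding E_tensor_def c[OF v] scal dim by (simp add: field_simps)
qed

end
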